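(* Let $\mathbb{K}$ be a field, let $G$ be a finite simple connected graph, and let $J_G$ be the parity binomial edge ideal of $G$ over $\mathbb{K}$. If the minimal graded free resolution of $J_G$ is pure, then $G$ is a bipartite graph or an odd cycle.
   Context: For a simple undirected graph $G$ with vertex set $V(G)$ and edge set $E(G)$, let $R=\mathbb{K}[x_i,y_i \mid i\in V(G)]$ with the standard grading (all variables of degree $1$). The parity binomial edge ideal of $G$ is the ideal $J_G=(x_ix_j-y_iy_j \mid \{i,j\}\in E(G))\subseteq R$. A graded free resolution $\mathbb{F}$ of a finitely generated graded $R$-module, with components $F_i=\bigoplus_j R(-j)^{\beta_{i,j}}$, is called pure if each $F_i$ is generated in a single degree, i.e. for each $i$ there is at most one $j$ with $\beta_{i,j}\neq 0$. (Purity of the minimal graded free resolution of $J_G$ is equivalent to purity of that of $R/J_G$.) An odd cycle is a cycle graph $C_n$ with $n\ge 3$ odd. *)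

theory Defs
  imports
    "HOL-Library.Poly_Mapping"
    "HOL-Algebra.Ideal"
    "Jordan_Normal_Form.Matrix"
    "Graph_Theory.Pair_Digraph"
    "Graph_Theory.Digraph_Component"
    "Graph_Theory.Digraph_Isomorphism"
begin

section \<open>Graphs\<close>

text \<open>
  A finite simple graph is a \<open>pair_graph\<close>: its arcs form an irreflexive symmetric relation, so that
  an edge \<open>{i,j}\<close> is present as the two arcs \<open>(i,j)\<close> and \<open>(j,i)\<close>.
\<close>

definition bipartite :: "'v pair_pre_digraph \<Rightarrow> bool" where
  "bipartite G \<longleftrightarrow> (\<exists>A B. A \<union> B = pverts G \<and> A \<inter> B = {} \<and>
     (\<forall>(u, v) \<in> parcs G. (u \<in> A \<and> v \<in> B) \<or> (u \<in> B \<and> v \<in> A)))"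

definition cycle_graph :: "nat \<Rightarrow> nat pair_pre_digraph" where
  "cycle_graph n = \<lparr> pverts = {..<n},
     parcs = {(i, j). i < n \<and> j < n \<and> (j = Suc i mod n \<or> i = Suc j mod n)} \<rparr>"

definition odd_cycle :: "'v pair_pre_digraph \<Rightarrow> bool" where
  "odd_cycle G \<longleftrightarrow> (\<exists>n\<ge>3. odd n \<and> digraph_iso (with_proj (cycle_graph n)) (with_proj G))"


section \<open>The polynomial ring and the parity binomial edge ideal\<close>

datatype 'v pvar = XVar 'v | YVar 'v

text \<open>Polynomials in all variables indexed by the type \<open>'v\<close>, as finitely supported maps from
  exponent vectors to coefficients.\<close>

type_synonym ('v, 'k) pvpoly = "('v pvar \<Rightarrow>\<^sub>0 nat) \<Rightarrow>\<^sub>0 'k"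

definition pvar_poly :: "'v pvar \<Rightarrow> ('v, 'k::comm_ring_1) pvpoly" where
  "pvar_poly z = Poly_Mapping.single (Poly_Mapping.single z 1) 1"

abbreviation poly_x :: "'v \<Rightarrow> ('v, 'k::comm_ring_1) pvpoly" where
  "poly_x i \<equiv> pvar_poly (XVar i)"

abbreviation poly_y :: "'v \<Rightarrow> ('v, 'k::comm_ring_1) pvpoly" where
  "poly_y i \<equiv> pvar_poly (YVar i)"

text \<open>The ring \<open>K[x\<^sub>i, y\<^sub>i | i \<in> V]\<close>: only variables with index in \<open>V\<close> may occur.\<close>

definition poly_ring :: "'v set \<Rightarrow> ('v, 'k::comm_ring_1) pvpoly ring" where
  "poly_ring V = \<lparr> carrier = {p. \<forall>m \<in> Poly_Mapping.keys p. Poly_Mapping.keys m \<subseteq> XVar ` V \<union> YVar ` V},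
     monoid.mult = (*), one = 1, zero = 0, add = (+) \<rparr>"

definition monom_degree :: "('v pvar \<Rightarrow>\<^sub>0 nat) \<Rightarrow> nat" where
  "monom_degree m = (\<Sum>z \<in> Poly_Mapping.keys m. Poly_Mapping.lookup m z)"

text \<open>Being zero or homogeneous of degree \<open>e\<close>; in particular only \<open>0\<close> qualifies if \<open>e < 0\<close>.\<close>

definition homogeneous :: "int \<Rightarrow> ('v, 'k::comm_ring_1) pvpoly \<Rightarrow> bool" where
  "homogeneous e p \<longleftrightarrow> (\<forall>m \<in> Poly_Mapping.keys p. int (monom_degree m) = e)"

definition irrelevant_ideal :: "'v set \<Rightarrow> ('v, 'k::comm_ring_1) pvpoly set" where
  "irrelevant_ideal V = genideal (poly_ring V) (poly_x ` V \<union> poly_y ` V)"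

definition parity_binomial_edge_ideal ::
    "'v pair_pre_digraph \<Rightarrow> ('v, 'k::comm_ring_1) pvpoly set" where
  "parity_binomial_edge_ideal G = genideal (poly_ring (pverts G))
     {poly_x i * poly_x j - poly_y i * poly_y j | i j. (i, j) \<in> parcs G}"


section \<open>Graded free resolutions of homogeneous ideals\<close>

text \<open>
  With \<open>R = poly_ring V\<close>, the \<open>i\<close>-th component of a complex is the graded free module
  \<open>F\<^sub>i = R(-d\<^sub>0) \<oplus> \<dots> \<oplus> R(-d\<^sub>r\<^sub>-\<^sub>1)\<close>, where \<open>shifts F i = [d\<^sub>0, \<dots>, d\<^sub>r\<^sub>-\<^sub>1]\<close>.
  All maps are given by their matrices in the standard bases: \<open>bdry F i\<close> is the matrix of
  \<open>F\<^sub>i\<^sub>+\<^sub>1 \<rightarrow> F\<^sub>i\<close>, and \<open>augm F\<close> is the row of the images of the basis of \<open>F\<^sub>0\<close> in the resolved ideal.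
\<close>

record (overloaded) ('v, 'k::zero) graded_complex =
  shifts :: "nat \<Rightarrow> int list"
  augm :: "('v, 'k) pvpoly vec"
  bdry :: "nat \<Rightarrow> ('v, 'k) pvpoly mat"

definition rank_at :: "('v, 'k::zero) graded_complex \<Rightarrow> nat \<Rightarrow> nat" where
  "rank_at F i = length (shifts F i)"

definition free_module :: "'v set \<Rightarrow> nat \<Rightarrow> ('v, 'k::comm_ring_1) pvpoly vec set" where
  "free_module V r = {v \<in> carrier_vec r. \<forall>k<r. v $ k \<in> carrier (poly_ring V)}"

text \<open>The matrices describe homomorphisms of degree \<open>0\<close>: a basis element of degree \<open>d\<close> has
  coordinate of degree \<open>d - e\<close> at a basis element of degree \<open>e\<close>.\<close>

definition graded_maps :: "'v set \<Rightarrow> ('v, 'k::comm_ring_1) graded_complex \<Rightarrow> bool" where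
  "graded_maps V F \<longleftrightarrow>
     augm F \<in> free_module V (rank_at F 0) \<and>
     (\<forall>k<rank_at F 0. homogeneous (shifts F 0 ! k) (augm F $ k)) \<and>
     (\<forall>i. bdry F i \<in> carrier_mat (rank_at F i) (rank_at F (Suc i)) \<and>
        (\<forall>l<rank_at F i. \<forall>k<rank_at F (Suc i).
           bdry F i $$ (l, k) \<in> carrier (poly_ring V) \<and>
           homogeneous (shifts F (Suc i) ! k - shifts F i ! l) (bdry F i $$ (l, k))))"

definition graded_free_resolution ::
    "'v set \<Rightarrow> ('v, 'k::comm_ring_1) pvpoly set \<Rightarrow> ('v, 'k) graded_complex \<Rightarrow> bool" where
  "graded_free_resolution V I F \<longleftrightarrow>
     graded_maps V F \<and>
     (\<lambda>v. augm F \<bullet> v) ` free_module V (rank_at F 0) = I \<and>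
     (\<lambda>v. bdry F 0 *\<^sub>v v) ` free_module V (rank_at F 1)
       = {w \<in> free_module V (rank_at F 0). augm F \<bullet> w = 0} \<and>
     (\<forall>i. (\<lambda>v. bdry F (Suc i) *\<^sub>v v) ` free_module V (rank_at F (Suc (Suc i)))
       = {w \<in> free_module V (rank_at F (Suc i)). bdry F i *\<^sub>v w = 0\<^sub>v (rank_at F i)})"

text \<open>Minimality: the image of \<open>F\<^sub>i\<^sub>+\<^sub>1\<close> lies in \<open>\<mm> F\<^sub>i\<close>, the vectors with all coordinates in the
  irrelevant ideal \<open>\<mm>\<close>.\<close>

definition minimal_graded_free_resolution ::
    "'v set \<Rightarrow> ('v, 'k::comm_ring_1) pvpoly set \<Rightarrow> ('v, 'k) graded_complex \<Rightarrow> bool" where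
  "minimal_graded_free_resolution V I F \<longleftrightarrow>
     graded_free_resolution V I F \<and>
     (\<forall>i. \<forall>v \<in> free_module V (rank_at F (Suc i)). \<forall>l<rank_at F i.
        (bdry F i *\<^sub>v v) $ l \<in> irrelevant_ideal V)"

text \<open>The multiplicity of \<open>R(-j)\<close> in \<open>F\<^sub>i\<close>.\<close>

definition betti :: "('v, 'k::zero) graded_complex \<Rightarrow> nat \<Rightarrow> int \<Rightarrow> nat" where
  "betti F i j = count_list (shifts F i) j"

definition pure_complex :: "('v, 'k::zero) graded_complex \<Rightarrow> bool" where
  "pure_complex F \<longleftrightarrow> (\<forall>i j j'. betti F i j \<noteq> 0 \<longrightarrow> betti F i j' \<noteq> 0 \<longrightarrow> j = j')"

end

theory Submission
  imports Defs "HOL-Computational_Algebra.Polynomial"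
begin

text \<open>
  Suppose the resolution \<open>F\<close> of \<open>J\<^sub>G\<close> is pure and \<open>G\<close> is neither bipartite nor an odd cycle. Then \<open>G\<close>
  has a vertex with three neighbours, and it contains a triangle or an induced path on four
  vertices. In either case a linear substitution maps the degree 2 part of \<open>J\<^sub>G\<close> onto the span of
  \<open>p\<^sup>2, p r - q\<^sup>2, r\<^sup>2\<close>. These three forms have no linear syzygies, and their quadratic
  syzygies are Koszul; comparing \<open>F\<close> with their Koszul complex shows that \<open>F\<^sub>1\<close> is generated in
  degree 4 and \<open>F\<^sub>2\<close> in degree at least 6. But at a vertex with three neighbours the
  Koszul syzygies and the Pluecker syzygy of the three edges satisfy a linear relation, so \<open>F\<^sub>2\<close> has a
  generator of degree 5. The substitution needs no assumption on the characteristic.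
\<close>

section \<open>Graphs\<close>

text \<open>The triangle or path and the vertex with three neighbours may lie far apart in
  \<open>G\<close>. Purity is what lets them contradict each other: each \<open>F\<^sub>i\<close>
  has a single degree, so a syzygy found anywhere speaks for the whole resolution. On a triangle or
  an induced path the three edge binomials form a regular sequence, but this has to be seen inside
  the resolution of the whole graph. The substitution achieves that by sending both variables of
  every vertex outside the configuration to 0, so that all edges leaving it disappear and only three
  forms survive. Control in degree 2 is enough, because purity also forces every generator of
  \<open>F\<^sub>0\<close> into degree 2. Cutting down further, to three variables, turns the facts
  needed about regular sequences into comparisons of finitely many coefficients. The two bounds
  collide because the linear relation at a vertex with three neighbours involves a non-Koszul
  quadratic syzygy, which is invisible after the substitution.\<close>

lemma connected_subset:
  assumes "pair_graph G" and "Digraph_Component.connected (with_proj G)"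
    and "u \<in> pverts G" "u \<in> S" and closed: "\<And>v w. (v, w) \<in> parcs G \<Longrightarrow> v \<in> S \<Longrightarrow> w \<in> S"
  shows "pverts G \<subseteq> S"
proof
  fix w assume w: "w \<in> pverts G"
  interpret pair_graph G by fact
  have "u \<rightarrow>\<^sup>*\<^bsub>with_proj (mk_symmetric (with_proj G))\<^esub> w"
    using assms(2,3) w by (auto simp: Digraph_Component.connected_def strongly_connected_def)
  \<comment> \<open>The arcs are already symmetric, so the symmetric closure in the notion of
    connectedness adds nothing.\<close>
  then have "u \<rightarrow>\<^sup>*\<^bsub>with_proj G\<^esub> w"
    using reachable_mk_symmetric_eq sym_arcs by (simp add: sym_arcs)
  then have "(u, w) \<in> (parcs G)\<^sup>*"
    unfolding reachable_def by (simp add: rtrancl_on_rtranclI)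
  then show "w \<in> S"
    by (induction rule: rtrancl_induct) (use assms closed in auto)
qed

text \<open>The parts are the neighbours of some vertex \<open>v\<close>, and \<open>v\<close>
  together with the vertices at distance two. An edge inside the first part closes a triangle with
  \<open>v\<close>; an edge from the second part that does not lead to a neighbour of
  \<open>v\<close> completes an induced path starting at \<open>v\<close>. In particular nothing
  lies at distance three.\<close>

lemma bipartite_if_no_triangle_no_induced_P4:
  assumes "pair_graph G" and "Digraph_Component.connected (with_proj G)"
    and no_triangle: "\<And>a b c. (a, b) \<in> parcs G \<Longrightarrow> (b, c) \<in> parcs G \<Longrightarrow> (a, c) \<notin> parcs G"
    and no_P4: "\<And>a b c d. (a, b) \<in> parcs G \<Longrightarrow> (b, c) \<in> parcs G \<Longrightarrow> (c, d) \<in> parcs G \<Longrightarrow>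
      distinct [a, b, c, d] \<Longrightarrow> (a, c) \<in> parcs G \<or> (b, d) \<in> parcs G \<or> (a, d) \<in> parcs G"
  shows "bipartite G"
proof -
  interpret pair_graph G by fact
  have sym: "(v, u) \<in> parcs G" if "(u, v) \<in> parcs G" for u v
    using that sym_arcs by (auto simp: symmetric_def dest: symD)
  have irr: "(u, u) \<notin> parcs G" for u
    using no_loops by fastforce
  obtain v where v: "v \<in> pverts G"
    using assms(2) by (auto simp: Digraph_Component.connected_def strongly_connected_def)
  define A where "A = {a. (v, a) \<in> parcs G}"
  define B where "B = {b. b = v \<or> (b \<notin> A \<and> (\<exists>a\<in>A. (a, b) \<in> parcs G))}"
  have step: "w \<in> A" if u: "u \<in> B" and uw: "(u, w) \<in> parcs G" for u w
  proof (rule ccontr)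
    assume w: "w \<notin> A"
    then have "u \<noteq> v" using uw by (auto simp: A_def)
    then obtain a where a: "a \<in> A" "(a, u) \<in> parcs G" "u \<notin> A"
      using u by (auto simp: B_def)
    have aw: "(a, w) \<notin> parcs G"
      using no_triangle[OF a(2) uw] .
    have "distinct [v, a, u, w]"
      using a w aw uw irr sym by (auto simp: A_def)
    then show False
      using no_P4[of v a u w] a w aw uw by (auto simp: A_def)
  qed
  have sub: "pverts G \<subseteq> A \<union> B"
  proof (rule connected_subset[OF assms(1,2) v])
    show "v \<in> A \<union> B" by (simp add: B_def)
    fix x y assume "(x, y) \<in> parcs G" "x \<in> A \<union> B"
    then show "y \<in> A \<union> B" using step[of x y] unfolding B_def by blast
  qed
  have disj: "A \<inter> B = {}" using irr by (auto simp: A_def B_def)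
  have AV: "A \<subseteq> pverts G" by (auto simp: A_def dest: in_arcsD2)
  have BV: "B \<subseteq> pverts G" using v by (auto simp: B_def dest: in_arcsD2)
  have "(x \<in> A \<and> y \<in> B) \<or> (x \<in> B \<and> y \<in> A)" if xy: "(x, y) \<in> parcs G" for x y
  proof (cases "x \<in> B")
    case True then show ?thesis using step xy by auto
  next
    case False
    then have x: "x \<in> A" using sub xy in_arcsD1 by blast
    then have "y \<notin> A" using no_triangle[of v x y] xy by (auto simp: A_def)
    then show ?thesis using x sub xy in_arcsD2 by blast
  qed
  then show ?thesis
    unfolding bipartite_def using sub AV BV disj by (intro exI[of _ A] exI[of _ B]) auto
qed

text \<open>A longest path covers the graph: at an end a new neighbour would extend it, and an inner
  vertex already has two neighbours. For the same reason any arc between non-consecutive positions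
  joins the two ends, and it spoils the colouring by parity of position only if the number of
  vertices is odd.\<close>

lemma bipartite_or_odd_cycle_if_degree_le_2:
  assumes "pair_graph G" and "Digraph_Component.connected (with_proj G)"
    and deg: "\<And>v a b c. (v, a) \<in> parcs G \<Longrightarrow> (v, b) \<in> parcs G \<Longrightarrow> (v, c) \<in> parcs G \<Longrightarrow>
      \<not> distinct [a, b, c]"
  shows "bipartite G \<or> odd_cycle G"
proof -
  interpret pair_graph G by fact
  have sym: "(v, u) \<in> parcs G" if "(u, v) \<in> parcs G" for u v
    using that sym_arcs by (auto simp: symmetric_def dest: symD)
  have irr: "(u, u) \<notin> parcs G" for u
    using no_loops by fastforce
  define path where "path xs \<longleftrightarrow> xs \<noteq> [] \<and> distinct xs \<and> set xs \<subseteq> pverts G \<and>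
    (\<forall>i. Suc i < length xs \<longrightarrow> (xs ! i, xs ! Suc i) \<in> parcs G)" for xs
  obtain v where "v \<in> pverts G"
    using assms(2) by (auto simp: Digraph_Component.connected_def strongly_connected_def)
  then have "path [v]" by (simp add: path_def)
  moreover have "length ys < Suc (card (pverts G))" if "path ys" for ys
    using that card_mono[OF pair_finite_verts, of "set ys"] distinct_card[of ys]
    by (simp add: path_def)
  ultimately obtain xs where xs: "path xs" and max: "\<And>ys. path ys \<Longrightarrow> length ys \<le> length xs"
    using ex_has_greatest_nat[of path "[v]" length "Suc (card (pverts G))"] by (metis less_imp_le)
  define n where "n = length xs"
  have n: "n > 0" and dist: "distinct xs" and arc: "Suc i < n \<Longrightarrow> (xs ! i, xs ! Suc i) \<in> parcs G" for i
    using xs by (auto simp: path_def n_def)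
  have arc': "0 < i \<Longrightarrow> i < n \<Longrightarrow> (xs ! i, xs ! (i - 1)) \<in> parcs G" for i
    using arc[of "i - 1"] sym by simp
  have eq: "xs ! i = xs ! j \<longleftrightarrow> i = j" if "i < n" "j < n" for i j
    using that dist by (simp add: n_def nth_eq_iff_index_eq)
  have closed: "w \<in> set xs" if u: "u \<in> set xs" and uw: "(u, w) \<in> parcs G" for u w
  proof (rule ccontr)
    assume w: "w \<notin> set xs"
    obtain i where i: "i < n" "u = xs ! i" using u by (auto simp: in_set_conv_nth n_def)
    consider "i = 0" | "Suc i = n" | "0 < i" "Suc i < n" using i by linarith
    then show False
    proof cases
      case 1
      then have "path (w # xs)"
        using xs w uw i sym in_arcsD2[OF uw] by (auto simp: path_def nth_Cons split: nat.splits)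
      then show False using max[of "w # xs"] by simp
    next
      case 2
      have "path (xs @ [w])"
        unfolding path_def
      proof (intro conjI allI impI)
        fix j assume "Suc j < length (xs @ [w])"
        then consider "Suc j < n" | "Suc j = n" by (fastforce simp: n_def)
        then show "((xs @ [w]) ! j, (xs @ [w]) ! Suc j) \<in> parcs G"
        proof cases
          case 1
          then show ?thesis using arc[of j] by (simp add: n_def nth_append)
        next
          case 2
          then have "j = i" using \<open>Suc i = n\<close> by simp
          then show ?thesis using 2 i uw by (simp add: n_def nth_append)
        qed
      qed (use xs w in_arcsD2[OF uw] in \<open>auto simp: path_def\<close>)
      then show False using max[of "xs @ [w]"] by simp
    next
      case 3
      have "distinct [xs ! (i - 1), xs ! Suc i, w]"
        using w 3 eq[of "i - 1" "Suc i"] nth_mem[of "i - 1" xs] nth_mem[of "Suc i" xs]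
        by (auto simp: n_def)
      then show False using deg[OF arc'[OF 3(1) i(1)] arc[OF 3(2)]] uw i by auto
    qed
  qed
  have verts: "pverts G = set xs"
  proof
    have x0: "xs ! 0 \<in> set xs" using n by (simp add: n_def)
    then have "xs ! 0 \<in> pverts G" using xs by (auto simp: path_def)
    from connected_subset[OF assms(1,2) this x0] show "pverts G \<subseteq> set xs"
      using closed by blast
  qed (use xs in \<open>simp add: path_def\<close>)
  have lt: "j = Suc i \<or> (i = 0 \<and> Suc j = n)"
    if ij: "i < j" "j < n" and e: "(xs ! i, xs ! j) \<in> parcs G" for i j
  proof (rule ccontr)
    assume neg: "\<not> ?thesis"
    then consider "0 < i" "Suc i < j" | "i = 0" "1 < j" "Suc j < n" using ij by fastforce
    then show False
    proof cases
      case 1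
      have "distinct [xs ! (i - 1), xs ! Suc i, xs ! j]"
        using 1 ij eq by auto
      then show False using deg[OF arc'[of i] arc[of i] e] 1 ij by auto
    next
      case 2
      have "distinct [xs ! (j - 1), xs ! Suc j, xs ! i]"
        using 2 ij eq by auto
      then show False using deg[OF arc'[of j] arc[of j] sym[OF e]] 2 ij by auto
    qed
  qed
  have arcs: "j = Suc i \<or> i = Suc j \<or> (i = 0 \<and> Suc j = n) \<or> (j = 0 \<and> Suc i = n)"
    if "i < n" "j < n" "(xs ! i, xs ! j) \<in> parcs G" for i j
    using lt[of i j] lt[of j i] that sym irr by (metis linorder_neqE_nat)
  have parcs_nth: "\<exists>i j. i < n \<and> j < n \<and> u = xs ! i \<and> w = xs ! j" if "(u, w) \<in> parcs G" for u w
    using in_arcsD1[OF that] in_arcsD2[OF that] unfolding verts in_set_conv_nth n_def by blast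
  show ?thesis
  proof (cases "odd n \<and> (xs ! 0, xs ! (n - 1)) \<in> parcs G")
    case False
    have par: "even i \<noteq> even j" if "i < n" "j < n" "(xs ! i, xs ! j) \<in> parcs G" for i j
    proof -
      have "even n" if "Suc i = n" "j = 0" using that False \<open>(xs ! i, xs ! j) \<in> parcs G\<close> sym by force
      moreover have "even n" if "Suc j = n" "i = 0" using that False \<open>(xs ! i, xs ! j) \<in> parcs G\<close> by force
      ultimately show ?thesis using arcs[OF that] by (metis even_Suc even_zero)
    qed
    define A where "A = {xs ! i | i. i < n \<and> even i}"
    define B where "B = {xs ! i | i. i < n \<and> odd i}"
    have "A \<union> B = pverts G" by (auto simp: A_def B_def verts set_conv_nth n_def)
    moreover have "A \<inter> B = {}" using eq by (auto simp: A_def B_def)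
    moreover have "(u \<in> A \<and> w \<in> B) \<or> (u \<in> B \<and> w \<in> A)" if uw: "(u, w) \<in> parcs G" for u w
    proof -
      obtain i j where ij: "i < n" "j < n" "u = xs ! i" "w = xs ! j" using parcs_nth[OF uw] by blast
      have AB: "xs ! m \<in> (if even m then A else B)" if "m < n" for m
        using that by (auto simp: A_def B_def)
      have "even i \<noteq> even j" using par[of i j] ij uw by simp
      then show ?thesis using AB[of i] AB[of j] ij by (cases "even i") simp_all
    qed
    ultimately have "bipartite G"
      unfolding bipartite_def by (intro exI[of _ A] exI[of _ B]) auto
    then show ?thesis ..
  next
    case True
    then have odd: "odd n" and last: "(xs ! 0, xs ! (n - 1)) \<in> parcs G" by auto
    \<comment> \<open>A single vertex would turn the closing arc into a loop, and two vertices are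
      excluded by parity.\<close>
    have "n \<noteq> 1" using last irr by auto
    then have n3: "n \<ge> 3" using odd n by (cases "n = 2") auto
    let ?f = "(!) xs"
    have cyc: "(?f i, ?f j) \<in> parcs G \<longleftrightarrow> (j = Suc i mod n \<or> i = Suc j mod n)"
      if ij: "i < n" "j < n" for i j
    proof -
      have s: "Suc k mod n = (if Suc k = n then 0 else Suc k)" if "k < n" for k
        using that by auto
      show ?thesis
      proof
        assume "(?f i, ?f j) \<in> parcs G"
        from arcs[OF ij this] show "j = Suc i mod n \<or> i = Suc j mod n"
          using s[of i] s[of j] ij by auto
      next
        assume r: "j = Suc i mod n \<or> i = Suc j mod n"
        have t: "(?f i', ?f j') \<in> parcs G" if "j' = Suc i' mod n" "i' < n" for i' j'
        proof (cases "Suc i' = n")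
          case True
          then have "i' = n - 1" "j' = 0" using that by auto
          then show ?thesis using sym[OF last] by simp
        next
          case False
          then show ?thesis using that arc[of i'] s[of i'] by simp
        qed
        show "(?f i, ?f j) \<in> parcs G" using r t[of j i] t[of i j] ij sym by blast
      qed
    qed
    let ?C = "with_proj (cycle_graph n)"
    define h :: "(nat, nat \<times> nat, 'a, 'a \<times> 'a) digraph_isomorphism" where
      "h = \<lparr> iso_verts = ?f, iso_arcs = map_prod ?f ?f, iso_head = snd, iso_tail = fst \<rparr>"
    have inj: "inj_on ?f {..<n}" using eq by (auto simp: inj_on_def)
    have "wf_digraph ?C"
      by (rule wf_digraph.intro) (auto simp: cycle_graph_def)
    moreover have "inj_on (map_prod ?f ?f) (parcs (cycle_graph n))"
      using eq by (auto simp: inj_on_def cycle_graph_def)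
    ultimately have "pre_digraph.digraph_isomorphism ?C h"
      unfolding pre_digraph.digraph_isomorphism_def using inj by (auto simp: h_def cycle_graph_def)
    moreover have "with_proj G = app_iso h ?C"
    proof -
      have "?f ` {..<n} = pverts G" by (auto simp: verts set_conv_nth n_def)
      moreover have "parcs G = map_prod ?f ?f ` parcs (cycle_graph n)"
      proof (intro equalityI subsetI)
        fix e assume e: "e \<in> parcs G"
        obtain u w where uw: "e = (u, w)" by force
        obtain i j where ij: "i < n" "j < n" "u = xs ! i" "w = xs ! j"
          using parcs_nth e uw by blast
        then have "(i, j) \<in> parcs (cycle_graph n)"
          using cyc[of i j] e uw by (simp add: cycle_graph_def)
        then show "e \<in> map_prod ?f ?f ` parcs (cycle_graph n)"
          using uw ij by force
      next
        fix e assume "e \<in> map_prod ?f ?f ` parcs (cycle_graph n)"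
        then show "e \<in> parcs G" using cyc by (auto simp: cycle_graph_def)
      qed
      ultimately show ?thesis
        by (simp add: app_iso_def h_def with_proj_def cycle_graph_def)
    qed
    ultimately show ?thesis
      unfolding odd_cycle_def digraph_iso_def using n3 odd by blast
  qed
qed

section \<open>Homogeneous components\<close>

lemma poly_mapping_sum_single:
  "p = (\<Sum>m\<in>Poly_Mapping.keys p. Poly_Mapping.single m (Poly_Mapping.lookup p m))"
  by (rule poly_mapping_eqI)
    (auto simp: lookup_sum lookup_single when_def sum.delta' in_keys_iff)

lemma monom_degree_superset:
  assumes "finite A" "Poly_Mapping.keys m \<subseteq> A"
  shows "monom_degree m = (\<Sum>z\<in>A. Poly_Mapping.lookup m z)"
  unfolding monom_degree_def using assms by (intro sum.mono_neutral_left) (auto simp: in_keys_iff)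

lemma monom_degree_add: "monom_degree (m + n) = monom_degree m + monom_degree n"
proof -
  let ?A = "Poly_Mapping.keys m \<union> Poly_Mapping.keys n"
  show ?thesis
    using monom_degree_superset[of ?A m] monom_degree_superset[of ?A n]
      monom_degree_superset[of ?A "m + n"] keys_add[of m n]
    by (simp add: lookup_add sum.distrib)
qed

lemma monom_degree_single [simp]: "monom_degree (Poly_Mapping.single z k) = k"
  by (simp add: monom_degree_def)

lemma monom_degree_eq_0_iff [simp]: "monom_degree m = 0 \<longleftrightarrow> m = 0"
  by (auto simp: monom_degree_def in_keys_iff intro!: poly_mapping_eqI)

lemma monom_degree_0 [simp]: "monom_degree 0 = 0"
  by simp

lemma monom_degree_SucE:
  assumes "monom_degree m = Suc d"
  obtains z n where "m = Poly_Mapping.single z 1 + n" "monom_degree n = d"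
proof -
  have "m \<noteq> 0" using assms by auto
  then obtain z where z: "Poly_Mapping.lookup m z \<noteq> 0"
    by (metis lookup_zero poly_mapping_eqI)
  define n where "n = m - Poly_Mapping.single z 1"
  have "m = Poly_Mapping.single z 1 + n"
    using z by (intro poly_mapping_eqI) (auto simp: n_def lookup_add lookup_minus lookup_single when_def)
  then show thesis
    using that[of z n] assms by (simp add: monom_degree_add)
qed

lemma homogeneous_0 [simp]: "homogeneous d 0"
  by (simp add: homogeneous_def)

lemma homogeneous_lookup:
  "homogeneous d p \<longleftrightarrow> (\<forall>m. Poly_Mapping.lookup p m \<noteq> 0 \<longrightarrow> int (monom_degree m) = d)"
  by (auto simp: homogeneous_def in_keys_iff)

lemma homogeneous_add: "homogeneous d p \<Longrightarrow> homogeneous d q \<Longrightarrow> homogeneous d (p + q)"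
  unfolding homogeneous_lookup lookup_add by (metis add_0)

lemma homogeneous_diff: "homogeneous d p \<Longrightarrow> homogeneous d q \<Longrightarrow> homogeneous d (p - q)"
  unfolding homogeneous_lookup lookup_minus by (metis diff_0_right)

lemma homogeneous_mult: "homogeneous d p \<Longrightarrow> homogeneous e q \<Longrightarrow> homogeneous (d + e) (p * q)"
  using keys_mult[of p q] by (fastforce simp: homogeneous_def monom_degree_add)

lemma homogeneous_neg: "homogeneous d p \<Longrightarrow> d < 0 \<Longrightarrow> p = 0"
  unfolding homogeneous_lookup by (intro poly_mapping_eqI) (metis lookup_zero of_nat_less_0_iff)

lemma homogeneous_single: "homogeneous (int (monom_degree m)) (Poly_Mapping.single m c)"
  by (simp add: homogeneous_def)

lemma homogeneous_pvar [simp]: "homogeneous 1 (pvar_poly z)"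
  by (simp add: homogeneous_def pvar_poly_def)

lemma homogeneous_0_const:
  assumes "homogeneous 0 p" shows "p = Poly_Mapping.single 0 (Poly_Mapping.lookup p 0)"
  using assms by (intro poly_mapping_eqI) (auto simp: homogeneous_lookup lookup_single when_def)

definition hom_part :: "int \<Rightarrow> ('v, 'k::comm_ring_1) pvpoly \<Rightarrow> ('v, 'k) pvpoly" where
  "hom_part d p = (\<Sum>m \<in> {m \<in> Poly_Mapping.keys p. int (monom_degree m) = d}.
     Poly_Mapping.single m (Poly_Mapping.lookup p m))"

lemma lookup_hom_part:
  "Poly_Mapping.lookup (hom_part d p) m = (if int (monom_degree m) = d then Poly_Mapping.lookup p m else 0)"
  by (auto simp: hom_part_def lookup_sum lookup_single when_def sum.delta' in_keys_iff)

lemma hom_part_homogeneous [simp]: "homogeneous d (hom_part d p)"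
  by (auto simp: homogeneous_lookup lookup_hom_part split: if_splits)

lemma hom_part_0 [simp]: "hom_part d 0 = 0"
  by (simp add: hom_part_def)

lemma hom_part_add: "hom_part d (p + q) = hom_part d p + hom_part d q"
  by (rule poly_mapping_eqI) (simp add: lookup_hom_part lookup_add)

lemma hom_part_sum: "hom_part d (\<Sum>i\<in>A. f i) = (\<Sum>i\<in>A. hom_part d (f i))"
  by (induction A rule: infinite_finite_induct) (auto simp: hom_part_add)

lemma hom_part_of_homogeneous:
  assumes "homogeneous e p" shows "hom_part d p = (if d = e then p else 0)"
  using assms by (intro poly_mapping_eqI) (auto simp: lookup_hom_part homogeneous_lookup)

text \<open>Both sides are additive in \<open>q\<close>, so a single term suffices; there the
  product is homogeneous and the two sides survive or vanish together.\<close>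

lemma hom_part_mult:
  assumes "homogeneous e p"
  shows "hom_part d (p * q) = p * hom_part (d - e) q"
proof -
  have single: "hom_part d (p * Poly_Mapping.single m c) = p * hom_part (d - e) (Poly_Mapping.single m c)" for m c
    using hom_part_of_homogeneous[OF homogeneous_mult[OF assms homogeneous_single[of m c]], of d]
      hom_part_of_homogeneous[OF homogeneous_single[of m c], of "d - e"]
    by (auto simp: algebra_simps)
  show ?thesis
    apply (subst (1 2) poly_mapping_sum_single[of q])
    apply (simp only: sum_distrib_left hom_part_sum single)
    done
qed

section \<open>Parity binomial edge ideals\<close>

lemma carrier_poly_ring_keys:
  "p \<in> carrier (poly_ring V) \<longleftrightarrow> (\<forall>m\<in>Poly_Mapping.keys p. Poly_Mapping.keys m \<subseteq> XVar ` V \<union> YVar ` V)"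
  by (simp add: poly_ring_def)

lemma poly_ring_simps [simp]:
  "monoid.mult (poly_ring V) = (*)" "monoid.one (poly_ring V) = 1" "ring.zero (poly_ring V) = 0" "ring.add (poly_ring V) = (+)"
  by (simp_all add: poly_ring_def)

lemma carrier_add: "p \<in> carrier (poly_ring V) \<Longrightarrow> q \<in> carrier (poly_ring V) \<Longrightarrow> p + q \<in> carrier (poly_ring V)"
  using keys_add[of p q] unfolding carrier_poly_ring_keys by blast

lemma carrier_uminus: "p \<in> carrier (poly_ring V) \<Longrightarrow> - p \<in> carrier (poly_ring V)"
  by (simp add: carrier_poly_ring_keys in_keys_iff)

lemma carrier_diff: "p \<in> carrier (poly_ring V) \<Longrightarrow> q \<in> carrier (poly_ring V) \<Longrightarrow> p - q \<in> carrier (poly_ring V)"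
  using carrier_add[OF _ carrier_uminus, of p V q] by simp

lemma carrier_mult:
  assumes "p \<in> carrier (poly_ring V)" "q \<in> carrier (poly_ring V)"
  shows "p * q \<in> carrier (poly_ring V)"
  unfolding carrier_poly_ring_keys
proof
  fix m assume "m \<in> Poly_Mapping.keys (p * q)"
  then obtain a b where "a \<in> Poly_Mapping.keys p" "b \<in> Poly_Mapping.keys q" "m = a + b"
    using keys_mult[of p q] by auto
  then show "Poly_Mapping.keys m \<subseteq> XVar ` V \<union> YVar ` V"
    using assms keys_add[of a b] unfolding carrier_poly_ring_keys by blast
qed

lemma carrier_single: "Poly_Mapping.keys m \<subseteq> XVar ` V \<union> YVar ` V \<Longrightarrow> Poly_Mapping.single m c \<in> carrier (poly_ring V)"
  by (simp add: carrier_poly_ring_keys)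

lemma carrier_0 [simp]: "0 \<in> carrier (poly_ring V)"
  by (simp add: carrier_poly_ring_keys)

lemma carrier_1 [simp]: "1 \<in> carrier (poly_ring V)"
  by (simp add: carrier_poly_ring_keys)

lemma carrier_const [simp]: "Poly_Mapping.single 0 c \<in> carrier (poly_ring V)"
  by (simp add: carrier_single)

lemma carrier_homogeneous_0: "homogeneous 0 p \<Longrightarrow> p \<in> carrier (poly_ring V)"
  using homogeneous_0_const[of p] carrier_const by metis

lemma carrier_x: "i \<in> V \<Longrightarrow> poly_x i \<in> carrier (poly_ring V)"
  and carrier_y: "i \<in> V \<Longrightarrow> poly_y i \<in> carrier (poly_ring V)"
  by (simp_all add: carrier_poly_ring_keys pvar_poly_def)

lemma ring_poly_ring: "ring (poly_ring V :: ('v, 'k::comm_ring_1) pvpoly ring)"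
proof (rule ringI)
  show "abelian_group (poly_ring V :: ('v, 'k) pvpoly ring)"
  proof (rule abelian_groupI)
    fix p :: "('v, 'k) pvpoly" assume "p \<in> carrier (poly_ring V)"
    then show "\<exists>q\<in>carrier (poly_ring V). q \<oplus>\<^bsub>poly_ring V\<^esub> p = \<zero>\<^bsub>poly_ring V\<^esub>"
      by (intro bexI[of _ "- p"]) (auto intro: carrier_uminus)
  qed (auto intro: carrier_add simp: ac_simps)
  show "monoid (poly_ring V :: ('v, 'k) pvpoly ring)"
    by (rule monoidI) (auto intro: carrier_mult simp: ac_simps)
qed (auto simp: algebra_simps)

definition edge_poly :: "'v \<Rightarrow> 'v \<Rightarrow> ('v, 'k::comm_ring_1) pvpoly" where
  "edge_poly i j = poly_x i * poly_x j - poly_y i * poly_y j"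

lemma homogeneous_edge_poly [simp]: "homogeneous 2 (edge_poly i j)"
proof -
  have "homogeneous (1 + 1) (edge_poly i j)"
    unfolding edge_poly_def by (intro homogeneous_diff homogeneous_mult homogeneous_pvar)
  then show ?thesis by simp
qed

lemma carrier_edge_poly: "i \<in> V \<Longrightarrow> j \<in> V \<Longrightarrow> edge_poly i j \<in> carrier (poly_ring V)"
  unfolding edge_poly_def by (intro carrier_diff carrier_mult carrier_x carrier_y)

lemma edge_poly_in_ideal:
  "(i, j) \<in> parcs G \<Longrightarrow> edge_poly i j \<in> parity_binomial_edge_ideal G"
  unfolding parity_binomial_edge_ideal_def genideal_def edge_poly_def by auto

text \<open>Needed for the triangle, where two of the three chosen elements of the ideal are
  differences of edge binomials.\<close>

lemma diff_in_ideal: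
  assumes wf: "pair_wf_digraph G"
    and "p \<in> parity_binomial_edge_ideal G" "q \<in> parity_binomial_edge_ideal G"
  shows "p - q \<in> parity_binomial_edge_ideal G"
proof -
  interpret pair_wf_digraph G by fact
  interpret R: ring "poly_ring (pverts G) :: ('a, 'b) pvpoly ring" by (rule ring_poly_ring)
  let ?S = "{poly_x i * poly_x j - poly_y i * poly_y j | i j. (i, j) \<in> parcs G} :: ('a, 'b) pvpoly set"
  have "?S \<subseteq> carrier (poly_ring (pverts G))"
    by (auto intro!: carrier_diff carrier_mult carrier_x carrier_y dest: in_arcsD1 in_arcsD2)
  then interpret J: ideal "parity_binomial_edge_ideal G" "poly_ring (pverts G) :: ('a, 'b) pvpoly ring"
    unfolding parity_binomial_edge_ideal_def by (rule R.genideal_ideal)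
  have carr: "q \<in> carrier (poly_ring (pverts G))" using assms J.Icarr by auto
  then have "\<ominus>\<^bsub>poly_ring (pverts G)\<^esub> q = - q"
    by (intro R.minus_equality) (auto intro: carrier_uminus)
  then have "- q \<in> parity_binomial_edge_ideal G" using J.a_inv_closed[OF assms(3)] by simp
  then show ?thesis using J.a_closed[OF assms(2), of "- q"] by simp
qed

section \<open>Substitution of univariate polynomials\<close>

definition monom_subst :: "('z \<Rightarrow> 'k::comm_ring_1 poly) \<Rightarrow> ('z \<Rightarrow>\<^sub>0 nat) \<Rightarrow> 'k poly" where
  "monom_subst \<sigma> m = (\<Prod>z\<in>Poly_Mapping.keys m. \<sigma> z ^ Poly_Mapping.lookup m z)"

definition poly_subst :: "('v pvar \<Rightarrow> 'k::comm_ring_1 poly) \<Rightarrow> ('v, 'k) pvpoly \<Rightarrow> 'k poly" where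
  "poly_subst \<sigma> p = (\<Sum>m\<in>Poly_Mapping.keys p. smult (Poly_Mapping.lookup p m) (monom_subst \<sigma> m))"

lemma monom_subst_superset:
  assumes "finite A" "Poly_Mapping.keys m \<subseteq> A"
  shows "monom_subst \<sigma> m = (\<Prod>z\<in>A. \<sigma> z ^ Poly_Mapping.lookup m z)"
  unfolding monom_subst_def using assms by (intro prod.mono_neutral_left) (auto simp: in_keys_iff)

lemma monom_subst_add: "monom_subst \<sigma> (m + n) = monom_subst \<sigma> m * monom_subst \<sigma> n"
proof -
  let ?A = "Poly_Mapping.keys m \<union> Poly_Mapping.keys n"
  show ?thesis
    using monom_subst_superset[of ?A m \<sigma>] monom_subst_superset[of ?A n \<sigma>]
      monom_subst_superset[of ?A "m + n" \<sigma>] keys_add[of m n]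
    by (simp add: lookup_add power_add prod.distrib)
qed

lemma monom_subst_0 [simp]: "monom_subst \<sigma> 0 = 1"
  by (simp add: monom_subst_def)

lemma monom_subst_single [simp]: "monom_subst \<sigma> (Poly_Mapping.single z (Suc 0)) = \<sigma> z"
  by (simp add: monom_subst_def)

lemma poly_subst_superset:
  assumes "finite A" "Poly_Mapping.keys p \<subseteq> A"
  shows "poly_subst \<sigma> p = (\<Sum>m\<in>A. smult (Poly_Mapping.lookup p m) (monom_subst \<sigma> m))"
  unfolding poly_subst_def using assms by (intro sum.mono_neutral_left) (auto simp: in_keys_iff)

lemma poly_subst_0 [simp]: "poly_subst \<sigma> 0 = 0"
  by (simp add: poly_subst_def)

lemma poly_subst_add: "poly_subst \<sigma> (p + q) = poly_subst \<sigma> p + poly_subst \<sigma> q"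
proof -
  let ?A = "Poly_Mapping.keys p \<union> Poly_Mapping.keys q"
  show ?thesis
    using poly_subst_superset[of ?A p \<sigma>] poly_subst_superset[of ?A q \<sigma>]
      poly_subst_superset[of ?A "p + q" \<sigma>] keys_add[of p q]
    by (simp add: lookup_add smult_add_left sum.distrib)
qed

lemma poly_subst_uminus: "poly_subst \<sigma> (- p) = - poly_subst \<sigma> p"
  using poly_subst_add[of \<sigma> p "- p"] by (simp add: eq_neg_iff_add_eq_0 add.commute)

lemma poly_subst_diff: "poly_subst \<sigma> (p - q) = poly_subst \<sigma> p - poly_subst \<sigma> q"
  using poly_subst_add[of \<sigma> p "- q"] by (simp add: poly_subst_uminus)

lemma poly_subst_sum: "poly_subst \<sigma> (\<Sum>i\<in>A. f i) = (\<Sum>i\<in>A. poly_subst \<sigma> (f i))"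
  by (induction A rule: infinite_finite_induct) (auto simp: poly_subst_add)

lemma poly_subst_single: "poly_subst \<sigma> (Poly_Mapping.single m c) = smult c (monom_subst \<sigma> m)"
  by (simp add: poly_subst_def)

lemma poly_subst_const [simp]: "poly_subst \<sigma> (Poly_Mapping.single 0 c) = [:c:]"
  by (simp add: poly_subst_single)

lemma poly_subst_pvar [simp]: "poly_subst \<sigma> (pvar_poly z) = \<sigma> z"
  by (simp add: poly_subst_single pvar_poly_def)

lemma poly_subst_mult: "poly_subst \<sigma> (p * q) = poly_subst \<sigma> p * poly_subst \<sigma> q"
proof -
  have "poly_subst \<sigma> (p * q) = poly_subst \<sigma> (\<Sum>m\<in>Poly_Mapping.keys p. \<Sum>n\<in>Poly_Mapping.keys q.
      Poly_Mapping.single (m + n) (Poly_Mapping.lookup p m * Poly_Mapping.lookup q n))"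
    by (subst (1) poly_mapping_sum_single[of p], subst (1) poly_mapping_sum_single[of q])
      (simp add: sum_product mult_single)
  also have "\<dots> = poly_subst \<sigma> p * poly_subst \<sigma> q"
    by (simp only: poly_subst_sum poly_subst_single monom_subst_add)
      (simp add: poly_subst_def sum_product mult.commute)
  finally show ?thesis .
qed

lemma poly_subst_edge_poly:
  "poly_subst \<sigma> (edge_poly i j) = \<sigma> (XVar i) * \<sigma> (XVar j) - \<sigma> (YVar i) * \<sigma> (YVar j)"
  by (simp add: edge_poly_def poly_subst_diff poly_subst_mult)

lemma poly_subst_const_mult: "poly_subst \<sigma> (Poly_Mapping.single 0 c * p) = smult c (poly_subst \<sigma> p)"
  by (simp add: poly_subst_mult)

text \<open>The two conclusions together cut out an ideal \<open>I\<close> containing the edge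
  binomials. A constant acts on the degree 2 part by a scalar, which \<open>L\<close> absorbs; a
  monomial of positive degree only moves parts of degree below 2, which are zero, into degree 2.
  Hence \<open>L\<close> need only be closed under linear combinations.\<close>

lemma parity_ideal_hom_part:
  fixes \<sigma> :: "'v pvar \<Rightarrow> 'k::comm_ring_1 poly"
  assumes wf: "pair_wf_digraph G"
    and L0: "0 \<in> L" and Ladd: "\<And>p q. p \<in> L \<Longrightarrow> q \<in> L \<Longrightarrow> p + q \<in> L"
    and Lsmult: "\<And>c p. p \<in> L \<Longrightarrow> smult c p \<in> L"
    and Ledge: "\<And>i j. (i, j) \<in> parcs G \<Longrightarrow> poly_subst \<sigma> (edge_poly i j) \<in> L"
    and p: "p \<in> parity_binomial_edge_ideal G"
  shows "d < 2 \<Longrightarrow> hom_part d p = 0" and "poly_subst \<sigma> (hom_part 2 p) \<in> L"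
proof -
  interpret pair_wf_digraph G by fact
  let ?R = "poly_ring (pverts G) :: ('v, 'k) pvpoly ring"
  define I where "I = {p \<in> carrier ?R. (\<forall>d<2. hom_part d p = 0) \<and> poly_subst \<sigma> (hom_part 2 p) \<in> L}"
  have I0: "0 \<in> I" using L0 by (simp add: I_def)
  have Iadd: "p + q \<in> I" if "p \<in> I" "q \<in> I" for p q
    using that Ladd by (simp add: I_def carrier_add hom_part_add poly_subst_add)
  have Ising: "Poly_Mapping.single m c * q \<in> I"
    if q: "q \<in> I" and m: "Poly_Mapping.keys m \<subseteq> XVar ` pverts G \<union> YVar ` pverts G" for m c q
  proof -
    have hp: "hom_part d (Poly_Mapping.single m c * q) =
        Poly_Mapping.single m c * hom_part (d - int (monom_degree m)) q" for d
      using hom_part_mult[OF homogeneous_single] .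
    have "poly_subst \<sigma> (hom_part 2 (Poly_Mapping.single m c * q)) \<in> L"
    proof (cases "m = 0")
      case True
      then have "hom_part 2 (Poly_Mapping.single m c * q) = Poly_Mapping.single 0 c * hom_part 2 q"
        using hp[of 2] by simp
      then show ?thesis using q Lsmult by (simp add: I_def poly_subst_const_mult)
    next
      case False
      then have "hom_part (2 - int (monom_degree m)) q = 0"
        using q monom_degree_eq_0_iff[of m] by (simp add: I_def del: monom_degree_eq_0_iff)
      then show ?thesis by (simp add: hp L0)
    qed
    then show ?thesis using q m by (auto simp: I_def hp intro!: carrier_mult carrier_single)
  qed
  have Isum: "(\<Sum>i\<in>A. f i) \<in> I" if "\<And>i. i \<in> A \<Longrightarrow> f i \<in> I" for A :: "('v pvar \<Rightarrow>\<^sub>0 nat) set" and f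
    using that by (induction A rule: infinite_finite_induct) (auto simp: I0 intro: Iadd)
  have Imult: "r * q \<in> I" if r: "r \<in> carrier ?R" and q: "q \<in> I" for r q
  proof -
    have "r * q = (\<Sum>m\<in>Poly_Mapping.keys r. Poly_Mapping.single m (Poly_Mapping.lookup r m) * q)"
      by (subst poly_mapping_sum_single[of r]) (simp add: sum_distrib_right)
    moreover have "\<dots> \<in> I"
      using r by (intro Isum Ising[OF q]) (simp add: carrier_poly_ring_keys)
    ultimately show ?thesis by simp
  qed
  have Imult': "q * r \<in> I" if "r \<in> carrier ?R" "q \<in> I" for r q
    using Imult[OF that] by (simp add: mult.commute)
  have ideal: "ideal I ?R"
  proof (rule idealI)
    interpret R: ring ?R by (rule ring_poly_ring)
    show "subgroup I (add_monoid ?R)"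
    proof (rule R.add.subgroupI)
      fix q assume q: "q \<in> I"
      then have qc: "q \<in> carrier ?R" by (simp add: I_def)
      have "\<ominus>\<^bsub>?R\<^esub> q = - q"
        using qc by (intro R.minus_equality) (auto intro: carrier_uminus)
      moreover have "- q \<in> I"
        using Imult[OF _ q, of "Poly_Mapping.single 0 (- 1)"]
        by (simp add: single_uminus carrier_uminus)
      ultimately show "\<ominus>\<^bsub>?R\<^esub> q \<in> I" by simp
    qed (use I0 Iadd in \<open>auto simp: I_def\<close>)
  qed (use Imult Imult' in \<open>auto intro: ring_poly_ring\<close>)
  have "poly_x i * poly_x j - poly_y i * poly_y j \<in> I" if ij: "(i, j) \<in> parcs G" for i j
  proof -
    have "edge_poly i j \<in> I"
      using ij Ledge[OF ij] in_arcsD1[OF ij] in_arcsD2[OF ij]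
      by (auto simp: I_def carrier_edge_poly hom_part_of_homogeneous[OF homogeneous_edge_poly])
    then show ?thesis by (simp add: edge_poly_def)
  qed
  then have "parity_binomial_edge_ideal G \<subseteq> I"
    unfolding parity_binomial_edge_ideal_def genideal_def using ideal by auto
  then show "d < 2 \<Longrightarrow> hom_part d p = 0" and "poly_subst \<sigma> (hom_part 2 p) \<in> L"
    using p by (auto simp: I_def)
qed

section \<open>Ternary forms\<close>

text \<open>
  Forms of degree at most 4 in three variables \<open>p, q, r\<close> are encoded faithfully as univariate
  polynomials by \<open>p = t\<close>, \<open>q = 1\<close>, \<open>r = t\<^sup>5\<close>. Under this encoding \<open>Q1 = p\<^sup>2\<close>,
  \<open>Q2 = p r - q\<^sup>2\<close> and \<open>Q3 = r\<^sup>2\<close>.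
\<close>

definition lin_form :: "'k::comm_ring_1 poly set" where
  "lin_form = {[:a, b, 0, 0, 0, c:] | a b c. True}"

text \<open>A monomial \<open>p^a q^b r^c\<close> becomes \<open>t^(a + 5 c)\<close>. With
  \<open>a \<le> 4\<close> the exponent gives back \<open>a\<close> and \<open>c\<close> as base 5
  digits, and the total degree gives \<open>b\<close>. The slots 0, 1, 2, 5, 6, 10 belong to
  \<open>q^2\<close>, \<open>p q\<close>, \<open>p^2\<close>, \<open>q r\<close>,
  \<open>p r\<close>, \<open>r^2\<close>.\<close>

definition quad_form :: "'k::comm_ring_1 poly set" where
  "quad_form = {[:a, b, c, 0, 0, d, e, 0, 0, 0, f:] | a b c d e f. True}"

definition Q1 :: "'k::comm_ring_1 poly" where "Q1 = [:0, 0, 1:]"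
definition Q2 :: "'k::comm_ring_1 poly" where "Q2 = [:- 1, 0, 0, 0, 0, 0, 1:]"
definition Q3 :: "'k::comm_ring_1 poly" where "Q3 = [:0, 0, 0, 0, 0, 0, 0, 0, 0, 0, 1:]"

lemma lin_form_0 [simp]: "0 \<in> lin_form"
  unfolding lin_form_def by (rule CollectI) (rule exI[of _ 0], simp)

lemma quad_form_0 [simp]: "0 \<in> quad_form"
  unfolding quad_form_def by (rule CollectI) (rule exI[of _ 0], simp)

lemma lin_form_const: "[:a:] \<in> lin_form"
  unfolding lin_form_def by (rule CollectI) (intro exI[of _ a] exI[of _ 0], simp)

lemma lin_form_add: "p \<in> lin_form \<Longrightarrow> q \<in> lin_form \<Longrightarrow> p + q \<in> lin_form"
  unfolding lin_form_def by force

lemma quad_form_add: "p \<in> quad_form \<Longrightarrow> q \<in> quad_form \<Longrightarrow> p + q \<in> quad_form"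
  unfolding quad_form_def by force

lemma lin_form_smult: "p \<in> lin_form \<Longrightarrow> smult c p \<in> lin_form"
  unfolding lin_form_def by force

lemma quad_form_smult: "p \<in> quad_form \<Longrightarrow> smult c p \<in> quad_form"
  unfolding quad_form_def by force

lemma lin_form_sum: "(\<And>i. i \<in> A \<Longrightarrow> f i \<in> lin_form) \<Longrightarrow> sum f A \<in> lin_form"
  by (induction A rule: infinite_finite_induct) (auto intro: lin_form_add)

lemma quad_form_sum: "(\<And>i. i \<in> A \<Longrightarrow> f i \<in> quad_form) \<Longrightarrow> sum f A \<in> quad_form"
  by (induction A rule: infinite_finite_induct) (auto intro: quad_form_add)

lemma lin_form_mult: "p \<in> lin_form \<Longrightarrow> q \<in> lin_form \<Longrightarrow> p * q \<in> quad_form"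
  unfolding lin_form_def quad_form_def by clarsimp

text \<open>Only \<open>b * Q2\<close> reaches the exponents 0, 1 and 5, where it shows the negated
  coefficients of \<open>b\<close>. Once \<open>b\<close> is gone, \<open>a * Q1\<close> and
  \<open>c * Q3\<close> have disjoint supports.\<close>

lemma linear_syzygy_trivial:
  fixes a b c :: "'k::comm_ring_1 poly"
  assumes "a \<in> lin_form" "b \<in> lin_form" "c \<in> lin_form"
    and "a * Q1 + b * Q2 + c * Q3 = 0"
  shows "a = 0 \<and> b = 0 \<and> c = 0"
  using assms by (auto simp: lin_form_def Q1_def Q2_def Q3_def)

text \<open>The scalars are coordinates with respect to the Koszul basis \<open>e12\<close>,
  \<open>e13\<close>, \<open>e23\<close>, where \<open>eij\<close> maps to
  \<open>Qi ej - Qj ei\<close>.\<close>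

lemma quadratic_syzygy_Koszul:
  fixes a b c :: "'k::comm_ring_1 poly"
  assumes "a \<in> quad_form" "b \<in> quad_form" "c \<in> quad_form"
    and "a * Q1 + b * Q2 + c * Q3 = 0"
  shows "\<exists>l12 l13 l23. a = - smult l12 Q2 - smult l13 Q3 \<and> b = smult l12 Q1 - smult l23 Q3 \<and>
    c = smult l13 Q1 + smult l23 Q2"
proof -
  obtain a1 a2 a3 a4 a5 a6 where a: "a = [:a1, a2, a3, 0, 0, a4, a5, 0, 0, 0, a6:]"
    using assms(1) by (auto simp: quad_form_def)
  obtain b1 b2 b3 b4 b5 b6 where b: "b = [:b1, b2, b3, 0, 0, b4, b5, 0, 0, 0, b6:]"
    using assms(2) by (auto simp: quad_form_def)
  obtain c1 c2 c3 c4 c5 c6 where c: "c = [:c1, c2, c3, 0, 0, c4, c5, 0, 0, 0, c6:]"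
    using assms(3) by (auto simp: quad_form_def)
  \<comment> \<open>The scalars are forced, since \<open>Q2\<close> contains neither
    \<open>p^2\<close> nor \<open>r^2\<close>: read off the coefficient of \<open>p^2\<close> in
    \<open>b\<close>, of \<open>r^2\<close> in \<open>a\<close> and of \<open>r^2\<close> in
    \<open>b\<close>, the last two with a change of sign.\<close>
  have "a = - smult b3 Q2 - smult (- a6) Q3 \<and> b = smult b3 Q1 - smult (- b6) Q3 \<and>
    c = smult (- a6) Q1 + smult (- b6) Q2"
    using assms(4) unfolding a b c by (auto simp: Q1_def Q2_def Q3_def eq_neg_iff_add_eq_0 add.commute)
  then show ?thesis by blast
qed

lemma monom_subst_lin:
  assumes "monom_degree m = 1" "\<And>z. \<sigma> z \<in> lin_form"
  shows "monom_subst \<sigma> m \<in> lin_form"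
  using monom_degree_SucE[of m 0] assms by (metis One_nat_def add.right_neutral monom_degree_eq_0_iff monom_subst_single)

lemma poly_subst_homogeneous_0:
  assumes "homogeneous 0 p" shows "poly_subst \<sigma> p = [:Poly_Mapping.lookup p 0:]"
  by (subst homogeneous_0_const[OF assms]) simp

lemma poly_subst_homogeneous_1:
  assumes "homogeneous 1 p" "\<And>z. \<sigma> z \<in> lin_form"
  shows "poly_subst \<sigma> p \<in> lin_form"
  unfolding poly_subst_def
  by (intro lin_form_sum lin_form_smult monom_subst_lin) (use assms in \<open>auto simp: homogeneous_def\<close>)

lemma poly_subst_homogeneous_2:
  assumes "homogeneous 2 p" and lin: "\<And>z. \<sigma> z \<in> lin_form"
  shows "poly_subst \<sigma> p \<in> quad_form"
  unfolding poly_subst_def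
proof (intro quad_form_sum quad_form_smult)
  fix m assume "m \<in> Poly_Mapping.keys p"
  then have "monom_degree m = Suc 1" using assms(1) by (auto simp: homogeneous_def)
  then obtain z n where "m = Poly_Mapping.single z 1 + n" "monom_degree n = 1"
    by (rule monom_degree_SucE)
  then show "monom_subst \<sigma> m \<in> quad_form"
    using monom_subst_lin[of n \<sigma>] lin by (simp add: monom_subst_add lin_form_mult)
qed

lemma lin_form_diff: "p \<in> lin_form \<Longrightarrow> q \<in> lin_form \<Longrightarrow> p - q \<in> lin_form"
  using lin_form_add[OF _ lin_form_smult, of p q "- 1"] by simp

lemma lin_form_1 [simp]: "1 \<in> lin_form"
  using lin_form_const[of 1] by (simp add: one_pCons)

lemma Q_nonzero: "(Q1 :: 'k::comm_ring_1 poly) \<noteq> 0"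
  by (simp add: Q1_def)

text \<open>As \<open>q = 1\<close>, constants are multiples of \<open>q\<close> and count as linear
  forms, so all degrees up to 1 can be treated alike.\<close>

lemma poly_subst_lin_form:
  assumes "homogeneous d p" "d \<le> 1" "\<And>z. \<sigma> z \<in> lin_form"
  shows "poly_subst \<sigma> p \<in> lin_form"
proof -
  consider "d < 0" | "d = 0" | "d = 1" using assms(2) by linarith
  then show ?thesis
  proof cases
    case 1 then show ?thesis using homogeneous_neg[OF assms(1)] by simp
  next
    case 2 then show ?thesis using assms(1) by (simp add: poly_subst_homogeneous_0 lin_form_const)
  next
    case 3 then show ?thesis using assms by (simp add: poly_subst_homogeneous_1)
  qed
qed

text \<open>The difference of two representations yields linear syzygies of \<open>Q1\<close>,
  \<open>Q2\<close>, \<open>Q3\<close>. In other words, the second Koszul differential is injective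
  on linear coefficients; its kernel starts with \<open>Q1 e23 - Q2 e13 + Q3 e12\<close>, which has
  quadratic ones. Two of the three components already determine everything.\<close>

lemma Koszul_syzygy_unique:
  fixes a b c a' b' c' :: "'k::comm_ring_1 poly"
  assumes lin: "a \<in> lin_form" "b \<in> lin_form" "c \<in> lin_form" "a' \<in> lin_form" "b' \<in> lin_form" "c' \<in> lin_form"
    and eq: "- a * Q2 - b * Q3 = - a' * Q2 - b' * Q3" "a * Q1 - c * Q3 = a' * Q1 - c' * Q3"
  shows "a = a' \<and> b = b' \<and> c = c'"
proof -
  have "(a - a') * Q2 + (b - b') * Q3 = (- a' * Q2 - b' * Q3) - (- a * Q2 - b * Q3)"
    "(a - a') * Q1 + (c' - c) * Q3 = (a * Q1 - c * Q3) - (a' * Q1 - c' * Q3)"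
    by (simp_all add: algebra_simps)
  then have "0 * Q1 + (a - a') * Q2 + (b - b') * Q3 = 0" "(a - a') * Q1 + 0 * Q2 + (c' - c) * Q3 = 0"
    unfolding eq by simp_all
  from linear_syzygy_trivial[OF _ _ _ this(1)] linear_syzygy_trivial[OF _ _ _ this(2)]
  show ?thesis using lin by (simp add: lin_form_diff)
qed

section \<open>Homogeneous lifts, and functionals on free modules\<close>

lemma homogeneous_lift:
  assumes M: "\<And>l k. l < n \<Longrightarrow> k < m \<Longrightarrow> homogeneous e (M l k)"
    and w: "\<And>l. l < n \<Longrightarrow> homogeneous d (w l)"
    and v: "\<And>l. l < n \<Longrightarrow> w l = (\<Sum>k<m. M l k * v k)"
  shows "\<exists>u. (\<forall>k. homogeneous (d - e) (u k)) \<and> (\<forall>l<n. w l = (\<Sum>k<m. M l k * u k))"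
\<comment> \<open>Since all entries of \<open>M\<close> have degree \<open>e\<close>, the parts of
  degree \<open>d - e\<close> of any solution solve the system again. For \<open>d < e\<close> they
  vanish, which is the source of the degree bounds below.\<close>
proof (intro exI[of _ "\<lambda>k. hom_part (d - e) (v k)"] conjI allI impI)
  fix l assume l: "l < n"
  have "w l = hom_part d (w l)" using hom_part_of_homogeneous[OF w[OF l]] by simp
  also have "\<dots> = (\<Sum>k<m. M l k * hom_part (d - e) (v k))"
    using l by (subst v) (auto simp: hom_part_sum hom_part_mult[OF M])
  finally show "w l = (\<Sum>k<m. M l k * hom_part (d - e) (v k))" .
qed simp

text \<open>The functional, linear over \<open>\<sigma>\<close>, that takes the scalar value
  \<open>q k\<close> at the k-th basis vector: one row of a comparison map to the Koszul
  complex.\<close>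

definition lin_eval :: "('v pvar \<Rightarrow> 'k::comm_ring_1 poly) \<Rightarrow> nat \<Rightarrow> (nat \<Rightarrow> 'k) \<Rightarrow> (nat \<Rightarrow> ('v, 'k) pvpoly) \<Rightarrow> 'k poly" where
  "lin_eval \<sigma> n q w = (\<Sum>k<n. smult (q k) (poly_subst \<sigma> (w k)))"

lemma smult_sum_right: "smult c (\<Sum>i\<in>I. f i) = (\<Sum>i\<in>I. smult c (f i))"
  by (induction I rule: infinite_finite_induct) (auto simp: smult_add_right)

lemma lin_eval_matrix:
  "lin_eval \<sigma> n q (\<lambda>l. \<Sum>k<m. M l k * u k) = (\<Sum>k<m. lin_eval \<sigma> n q (\<lambda>l. M l k) * poly_subst \<sigma> (u k))"
  unfolding lin_eval_def poly_subst_sum poly_subst_mult smult_sum_right sum_distrib_right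
  by (subst sum.swap) simp

lemma lin_eval_cong: "(\<And>k. k < n \<Longrightarrow> w k = w' k) \<Longrightarrow> lin_eval \<sigma> n q w = lin_eval \<sigma> n q w'"
  by (simp add: lin_eval_def)

lemma lin_eval_add: "lin_eval \<sigma> n q (\<lambda>k. w k + w' k) = lin_eval \<sigma> n q w + lin_eval \<sigma> n q w'"
  by (simp add: lin_eval_def poly_subst_add smult_add_right sum.distrib)

lemma lin_eval_diff: "lin_eval \<sigma> n q (\<lambda>k. w k - w' k) = lin_eval \<sigma> n q w - lin_eval \<sigma> n q w'"
  by (simp add: lin_eval_def poly_subst_diff smult_diff_right sum_subtractf)

lemma lin_eval_mult: "lin_eval \<sigma> n q (\<lambda>k. f * w k) = poly_subst \<sigma> f * lin_eval \<sigma> n q w"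
  by (simp add: lin_eval_def poly_subst_mult sum_distrib_left)

lemma lin_eval_0 [simp]: "lin_eval \<sigma> n q (\<lambda>k. 0) = 0"
  by (simp add: lin_eval_def)

lemma lin_eval_lin_form:
  assumes "\<And>k. k < n \<Longrightarrow> homogeneous d (w k)" "d \<le> 1" "\<And>z. \<sigma> z \<in> lin_form"
  shows "lin_eval \<sigma> n q w \<in> lin_form"
  unfolding lin_eval_def
  by (intro lin_form_sum lin_form_smult poly_subst_lin_form[OF _ assms(2)]) (use assms in auto)

lemma lin_eval_quad_form:
  assumes "\<And>k. k < n \<Longrightarrow> homogeneous 2 (w k)" "\<And>z. \<sigma> z \<in> lin_form"
  shows "lin_eval \<sigma> n q w \<in> quad_form"
  unfolding lin_eval_def
  by (intro quad_form_sum quad_form_smult poly_subst_homogeneous_2) (use assms in auto)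

definition Q_span :: "'k::comm_ring_1 poly set" where
  "Q_span = {smult a Q1 + smult b Q2 + smult c Q3 | a b c. True}"

lemma Q_span_0: "0 \<in> Q_span"
  unfolding Q_span_def by (rule CollectI) (rule exI[of _ 0], rule exI[of _ 0], rule exI[of _ 0], simp)

lemma Q_span_add: "p \<in> Q_span \<Longrightarrow> q \<in> Q_span \<Longrightarrow> p + q \<in> Q_span"
  unfolding Q_span_def
proof clarsimp
  fix a b c a' b' c' :: 'a
  show "\<exists>a'' b'' c''. smult a Q1 + smult b Q2 + smult c Q3 + (smult a' Q1 + smult b' Q2 + smult c' Q3) =
      smult a'' Q1 + smult b'' Q2 + smult c'' Q3"
    by (rule exI[of _ "a + a'"], rule exI[of _ "b + b'"], rule exI[of _ "c + c'"]) (simp add: smult_add_left)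
qed

lemma Q_span_smult: "p \<in> Q_span \<Longrightarrow> smult d p \<in> Q_span"
  unfolding Q_span_def by (force simp: smult_add_right)

section \<open>Determinantal identities behind the syzygies\<close>

lemma Koszul_identity:
  fixes f1 f2 f3 c1 c2 c3 :: "'a::comm_ring_1"
  shows "f1 * (f2 * c3 - f3 * c2) - f2 * (f1 * c3 - f3 * c1) + f3 * (f1 * c2 - f2 * c1) = 0"
  by (simp add: algebra_simps)

text \<open>This is the determinant with columns i, j, k and rows \<open>x\<close>,
  \<open>y\<close>, \<open>xv x - yv y\<close>, expanded along the last row, which is a combination
  of the other two.\<close>

lemma Pluecker_identity:
  fixes xi yi xj yj xk yk xv yv :: "'a::comm_ring_1"
  shows "(xj * yk - xk * yj) * (xv * xi - yv * yi) - (xi * yk - xk * yi) * (xv * xj - yv * yj)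
    + (xi * yj - xj * yi) * (xv * xk - yv * yk) = 0"
  by (simp add: algebra_simps)

text \<open>The first three terms form the determinant with rows \<open>x\<close>,
  \<open>xv x - yv y\<close>, \<open>c\<close>, which equals \<open>- yv\<close> times the one with
  rows \<open>x\<close>, \<open>y\<close>, \<open>c\<close>. The last term is \<open>yv\<close>
  times the latter, expanded along \<open>c\<close>.\<close>

lemma claw_identity:
  fixes xi yi xj yj xk yk xv yv ci cj ck :: "'a::comm_ring_1"
  shows "xi * ((xv * xj - yv * yj) * ck - (xv * xk - yv * yk) * cj)
    - xj * ((xv * xi - yv * yi) * ck - (xv * xk - yv * yk) * ci)
    + xk * ((xv * xi - yv * yi) * cj - (xv * xj - yv * yj) * ci)
    + yv * ((xj * yk - xk * yj) * ci - (xi * yk - xk * yi) * cj + (xi * yj - xj * yi) * ck) = 0"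
  by (simp add: algebra_simps)

section \<open>Two steps of a pure resolution\<close>

text \<open>
  The maps \<open>F\<^sub>0 \<rightarrow> J\<close>, \<open>F\<^sub>1 \<rightarrow> F\<^sub>0\<close> and \<open>F\<^sub>2 \<rightarrow> F\<^sub>1\<close> have the matrices \<open>A\<close>, \<open>B\<close> and \<open>D\<close>; purity means that
  all entries of a matrix have the same degree. Elements of \<open>F\<^sub>i\<close> are functions of which only the
  values below \<open>r\<^sub>i\<close> matter.
\<close>

locale two_syzygies =
  fixes V :: "'v set" and J :: "('v, 'k::comm_ring_1) pvpoly set"
    and A :: "nat \<Rightarrow> ('v, 'k) pvpoly" and B D :: "nat \<Rightarrow> nat \<Rightarrow> ('v, 'k) pvpoly"
    and r0 r1 r2 :: nat and b c :: int
  assumes A_hom: "k < r0 \<Longrightarrow> homogeneous 2 (A k)"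
    and B_hom: "l < r0 \<Longrightarrow> k < r1 \<Longrightarrow> homogeneous b (B l k)"
    and D_hom: "l < r1 \<Longrightarrow> k < r2 \<Longrightarrow> homogeneous c (D l k)"
    and AB: "k < r1 \<Longrightarrow> (\<Sum>l<r0. A l * B l k) = 0"
    and BD: "l < r0 \<Longrightarrow> k < r2 \<Longrightarrow> (\<Sum>j<r1. B l j * D j k) = 0"
    and A_surj: "p \<in> J \<Longrightarrow> \<exists>v. p = (\<Sum>k<r0. A k * v k)"
    and B_surj: "(\<And>l. l < r0 \<Longrightarrow> w l \<in> carrier (poly_ring V)) \<Longrightarrow> (\<Sum>l<r0. A l * w l) = 0 \<Longrightarrow>
      \<exists>v. \<forall>l<r0. w l = (\<Sum>k<r1. B l k * v k)"
    and D_surj: "(\<And>l. l < r1 \<Longrightarrow> w l \<in> carrier (poly_ring V)) \<Longrightarrow>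
      (\<And>l. l < r0 \<Longrightarrow> (\<Sum>k<r1. B l k * w k) = 0) \<Longrightarrow>
      \<exists>v. \<forall>l<r1. w l = (\<Sum>k<r2. D l k * v k)"
begin

lemma generator_lift:
  assumes "p \<in> J" "homogeneous 2 p"
  obtains u where "\<And>k. homogeneous 0 (u k)" "p = (\<Sum>k<r0. A k * u k)"
proof -
  obtain v where v: "p = (\<Sum>k<r0. A k * v k)" using A_surj[OF assms(1)] by blast
  \<comment> \<open>The generators form a matrix with a single row, hence the dummy index below
    1.\<close>
  have "\<exists>u. (\<forall>k. homogeneous (2 - 2) (u k)) \<and> (\<forall>l<1::nat. p = (\<Sum>k<r0. A k * u k))"
    by (rule homogeneous_lift[where M = "\<lambda>_. A"]) (use A_hom assms v in auto)
  then show thesis using that by auto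
qed

lemma syzygy_lift:
  assumes "\<And>l. l < r0 \<Longrightarrow> w l \<in> carrier (poly_ring V)" "\<And>l. l < r0 \<Longrightarrow> homogeneous 2 (w l)"
    and "(\<Sum>l<r0. A l * w l) = 0"
  obtains u where "\<And>k. homogeneous (2 - b) (u k)" "\<And>l. l < r0 \<Longrightarrow> w l = (\<Sum>k<r1. B l k * u k)"
proof -
  obtain v where v: "\<And>l. l < r0 \<Longrightarrow> w l = (\<Sum>k<r1. B l k * v k)" using B_surj assms by blast
  show thesis
    using homogeneous_lift[of r0 r1 b B 2 w v, OF B_hom assms(2) v] that by blast
qed

text \<open>As \<open>u\<close> and \<open>v\<close> express \<open>f\<close> and \<open>g\<close>
  through the generators, \<open>f v - g u\<close> is their Koszul syzygy in
  \<open>F\<^sub>0\<close>. Its entries are quadratic, so it lifts to \<open>F\<^sub>1\<close> with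
  coordinates of degree \<open>2 - b\<close>.\<close>

lemma Koszul_lift:
  assumes f: "f \<in> carrier (poly_ring V)" "homogeneous 2 f" "f = (\<Sum>k<r0. A k * u k)" "\<And>k. homogeneous 0 (u k)"
    and g: "g \<in> carrier (poly_ring V)" "homogeneous 2 g" "g = (\<Sum>k<r0. A k * v k)" "\<And>k. homogeneous 0 (v k)"
  obtains h where "\<And>k. homogeneous (2 - b) (h k)"
    "\<And>l. l < r0 \<Longrightarrow> f * v l - g * u l = (\<Sum>k<r1. B l k * h k)"
proof -
  have "(\<Sum>l<r0. A l * (f * v l - g * u l)) = f * (\<Sum>l<r0. A l * v l) - g * (\<Sum>l<r0. A l * u l)"
    by (simp add: algebra_simps sum_subtractf sum_distrib_left)
  also have "\<dots> = 0" using f(3) g(3) by (metis diff_self mult.commute)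
  finally have zero: "(\<Sum>l<r0. A l * (f * v l - g * u l)) = 0" .
  show thesis
  proof (rule syzygy_lift[OF _ _ zero])
    fix l
    show "f * v l - g * u l \<in> carrier (poly_ring V)"
      by (intro carrier_diff carrier_mult f g carrier_homogeneous_0)
    show "homogeneous 2 (f * v l - g * u l)"
      using homogeneous_diff homogeneous_mult[OF f(2) g(4)] homogeneous_mult[OF g(2) f(4)] by fastforce
  qed (use that in blast)
qed

text \<open>The Koszul syzygies of \<open>f1\<close>, \<open>f2\<close>, \<open>f3\<close> lift to
  the resolution, and mapping the lifts back to the Koszul complex of \<open>Q1\<close>,
  \<open>Q2\<close>, \<open>Q3\<close> must return the Koszul elements. Columns of \<open>B\<close>
  or \<open>D\<close> of degree below 2 would map to zero for want of linear syzygies, and so could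
  not produce them.\<close>

lemma regular_triple_degrees:
  assumes lin: "\<And>z. \<sigma> z \<in> lin_form"
    and A_span: "\<And>k. k < r0 \<Longrightarrow> poly_subst \<sigma> (A k) \<in> Q_span"
    and f: "f1 \<in> J" "f2 \<in> J" "f3 \<in> J"
    and f_hom: "homogeneous 2 f1" "homogeneous 2 f2" "homogeneous 2 f3"
    and f_carr: "f1 \<in> carrier (poly_ring V)" "f2 \<in> carrier (poly_ring V)" "f3 \<in> carrier (poly_ring V)"
    and sub: "poly_subst \<sigma> f1 = Q1" "poly_subst \<sigma> f2 = Q2" "poly_subst \<sigma> f3 = Q3"
  shows "b = 2 \<and> c \<ge> 2"
proof -
  have "\<exists>q1 q2 q3. \<forall>k<r0. poly_subst \<sigma> (A k) = smult (q1 k) Q1 + smult (q2 k) Q2 + smult (q3 k) Q3"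
    using A_span unfolding Q_span_def mem_Collect_eq by metis
  then obtain q1 q2 q3 where q:
    "\<And>k. k < r0 \<Longrightarrow> poly_subst \<sigma> (A k) = smult (q1 k) Q1 + smult (q2 k) Q2 + smult (q3 k) Q3"
    by blast
  txt \<open>\<open>?\<phi> q1\<close>, \<open>?\<phi> q2\<close>, \<open>?\<phi> q3\<close> form a map over \<open>\<sigma>\<close> from \<open>F\<^sub>0\<close> to the Koszul complex of
    \<open>Q1, Q2, Q3\<close>; below, \<open>?\<psi>\<close> extends it to \<open>F\<^sub>1\<close>.\<close>
  let ?\<phi> = "lin_eval \<sigma> r0"
  have \<phi>: "?\<phi> q1 w * Q1 + ?\<phi> q2 w * Q2 + ?\<phi> q3 w * Q3 = poly_subst \<sigma> (\<Sum>k<r0. A k * w k)" for w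
  proof -
    have "poly_subst \<sigma> (\<Sum>k<r0. A k * w k) =
        (\<Sum>k<r0. (smult (q1 k) Q1 + smult (q2 k) Q2 + smult (q3 k) Q3) * poly_subst \<sigma> (w k))"
      by (simp add: poly_subst_sum poly_subst_mult q)
    also have "\<dots> = ?\<phi> q1 w * Q1 + ?\<phi> q2 w * Q2 + ?\<phi> q3 w * Q3"
      by (simp add: lin_eval_def distrib_left distrib_right sum.distrib sum_distrib_right sum_distrib_left mult.commute)
    finally show ?thesis by simp
  qed
  obtain c1 where c1: "\<And>k. homogeneous 0 (c1 k)" "f1 = (\<Sum>k<r0. A k * c1 k)"
    using generator_lift[OF f(1) f_hom(1)] by blast
  obtain c2 where c2: "\<And>k. homogeneous 0 (c2 k)" "f2 = (\<Sum>k<r0. A k * c2 k)"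
    using generator_lift[OF f(2) f_hom(2)] by blast
  obtain c3 where c3: "\<And>k. homogeneous 0 (c3 k)" "f3 = (\<Sum>k<r0. A k * c3 k)"
    using generator_lift[OF f(3) f_hom(3)] by blast
  have lin0: "lin_eval \<sigma> n q w \<in> lin_form" if "\<And>k. homogeneous 0 (w k)" for n q w
    using that lin by (intro lin_eval_lin_form[where d = 0]) auto
  \<comment> \<open>\<open>c1\<close> represents \<open>f1\<close>, which goes to \<open>Q1\<close>.
    Without linear syzygies the coordinates of its image are unique, so they are those of the first
    basis vector.\<close>
  have \<phi>c1: "?\<phi> q1 c1 = 1 \<and> ?\<phi> q2 c1 = 0 \<and> ?\<phi> q3 c1 = 0"
    using linear_syzygy_trivial[of "?\<phi> q1 c1 - 1" "?\<phi> q2 c1" "?\<phi> q3 c1"] \<phi>[of c1] c1(2)[symmetric] sub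
      lin0[of c1, OF c1(1)] by (simp add: lin_form_diff algebra_simps)
  have \<phi>c2: "?\<phi> q1 c2 = 0 \<and> ?\<phi> q2 c2 = 1 \<and> ?\<phi> q3 c2 = 0"
    using linear_syzygy_trivial[of "?\<phi> q1 c2" "?\<phi> q2 c2 - 1" "?\<phi> q3 c2"] \<phi>[of c2] c2(2)[symmetric] sub
      lin0[of c2, OF c2(1)] by (simp add: lin_form_diff algebra_simps)
  have \<phi>c3: "?\<phi> q1 c3 = 0 \<and> ?\<phi> q2 c3 = 0 \<and> ?\<phi> q3 c3 = 1"
    using linear_syzygy_trivial[of "?\<phi> q1 c3" "?\<phi> q2 c3" "?\<phi> q3 c3 - 1"] \<phi>[of c3] c3(2)[symmetric] sub
      lin0[of c3, OF c3(1)] by (simp add: lin_form_diff algebra_simps)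
  have \<phi>K: "?\<phi> q (\<lambda>l. g * u l - h * v l) = poly_subst \<sigma> g * ?\<phi> q u - poly_subst \<sigma> h * ?\<phi> q v" for q g h u v
    by (simp add: lin_eval_diff lin_eval_mult)
  have \<phi>B: "?\<phi> q (\<lambda>l. g * u l - h * v l) = (\<Sum>k<r1. ?\<phi> q (\<lambda>l. B l k) * poly_subst \<sigma> (w k))"
    if "\<And>l. l < r0 \<Longrightarrow> g * u l - h * v l = (\<Sum>k<r1. B l k * w k)" for q g h u v w
    using lin_eval_cong[of r0, OF that] by (simp add: lin_eval_matrix)
  obtain k12 where k12: "\<And>k. homogeneous (2 - b) (k12 k)"
    "\<And>l. l < r0 \<Longrightarrow> f1 * c2 l - f2 * c1 l = (\<Sum>k<r1. B l k * k12 k)"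
    using Koszul_lift[OF f_carr(1) f_hom(1) c1(2,1) f_carr(2) f_hom(2) c2(2,1)] by blast
  obtain k13 where k13: "\<And>k. homogeneous (2 - b) (k13 k)"
    "\<And>l. l < r0 \<Longrightarrow> f1 * c3 l - f3 * c1 l = (\<Sum>k<r1. B l k * k13 k)"
    using Koszul_lift[OF f_carr(1) f_hom(1) c1(2,1) f_carr(3) f_hom(3) c3(2,1)] by blast
  obtain k23 where k23: "\<And>k. homogeneous (2 - b) (k23 k)"
    "\<And>l. l < r0 \<Longrightarrow> f2 * c3 l - f3 * c2 l = (\<Sum>k<r1. B l k * k23 k)"
    using Koszul_lift[OF f_carr(2) f_hom(2) c2(2,1) f_carr(3) f_hom(3) c3(2,1)] by blast
  have K12: "(\<Sum>k<r1. ?\<phi> q2 (\<lambda>l. B l k) * poly_subst \<sigma> (k12 k)) = Q1"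
    using \<phi>B[OF k12(2), of q2] \<phi>c1 \<phi>c2 by (simp add: \<phi>K sub)
  have B0: "?\<phi> q1 (\<lambda>l. B l k) * Q1 + ?\<phi> q2 (\<lambda>l. B l k) * Q2 + ?\<phi> q3 (\<lambda>l. B l k) * Q3 = 0"
    if "k < r1" for k
    using AB[OF that] by (simp add: \<phi>)
  \<comment> \<open>Below 2 the columns of \<open>B\<close> map to linear syzygies, which vanish;
    above 2 the lift \<open>k12\<close> has negative degree and vanishes. Both contradict
    \<open>K12\<close>.\<close>
  have b2: "b = 2"
  proof (rule ccontr)
    assume "b \<noteq> 2"
    then consider "b \<le> 1" | "b \<ge> 3" by linarith
    then show False
    proof cases
      case 1
      have "?\<phi> q2 (\<lambda>l. B l k) = 0" if k: "k < r1" for k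
      proof -
        have "?\<phi> q (\<lambda>l. B l k) \<in> lin_form" for q
          by (rule lin_eval_lin_form[OF B_hom[OF _ k] 1 lin])
        then show ?thesis using linear_syzygy_trivial[OF _ _ _ B0[OF k]] by blast
      qed
      then show False using K12 by (simp add: Q_nonzero)
    next
      case 2
      then have "k12 k = 0" for k using homogeneous_neg[OF k12(1)] by simp
      then show False using K12 by (simp add: Q_nonzero)
    qed
  qed
  have "\<exists>L12 L13 L23. \<forall>k<r1. ?\<phi> q1 (\<lambda>l. B l k) = - smult (L12 k) Q2 - smult (L13 k) Q3 \<and>
      ?\<phi> q2 (\<lambda>l. B l k) = smult (L12 k) Q1 - smult (L23 k) Q3 \<and>
      ?\<phi> q3 (\<lambda>l. B l k) = smult (L13 k) Q1 + smult (L23 k) Q2"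
  proof -
    have "\<exists>l12 l13 l23. ?\<phi> q1 (\<lambda>l. B l k) = - smult l12 Q2 - smult l13 Q3 \<and>
      ?\<phi> q2 (\<lambda>l. B l k) = smult l12 Q1 - smult l23 Q3 \<and>
      ?\<phi> q3 (\<lambda>l. B l k) = smult l13 Q1 + smult l23 Q2" if k: "k < r1" for k
      by (rule quadratic_syzygy_Koszul[OF _ _ _ B0[OF k]]; rule lin_eval_quad_form[OF _ lin])
        (use B_hom k b2 in auto)
    then show ?thesis by metis
  qed
  then obtain L12 L13 L23 where L: "\<And>k. k < r1 \<Longrightarrow> ?\<phi> q1 (\<lambda>l. B l k) = - smult (L12 k) Q2 - smult (L13 k) Q3"
      "\<And>k. k < r1 \<Longrightarrow> ?\<phi> q2 (\<lambda>l. B l k) = smult (L12 k) Q1 - smult (L23 k) Q3"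
    by blast
  let ?\<psi> = "lin_eval \<sigma> r1"
  have \<kappa>1: "(\<Sum>k<r1. ?\<phi> q1 (\<lambda>l. B l k) * poly_subst \<sigma> (w k)) = - ?\<psi> L12 w * Q2 - ?\<psi> L13 w * Q3" for w
  proof -
    have "(\<Sum>k<r1. ?\<phi> q1 (\<lambda>l. B l k) * poly_subst \<sigma> (w k)) =
        (\<Sum>k<r1. (- smult (L12 k) Q2 - smult (L13 k) Q3) * poly_subst \<sigma> (w k))"
      by (intro sum.cong) (simp_all only: lessThan_iff L(1))
    then show ?thesis
      by (simp only:) (simp add: lin_eval_def algebra_simps sum_subtractf sum.distrib sum_distrib_left sum_negf)
  qed
  have \<kappa>2: "(\<Sum>k<r1. ?\<phi> q2 (\<lambda>l. B l k) * poly_subst \<sigma> (w k)) = ?\<psi> L12 w * Q1 - ?\<psi> L23 w * Q3" for w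
  proof -
    have "(\<Sum>k<r1. ?\<phi> q2 (\<lambda>l. B l k) * poly_subst \<sigma> (w k)) =
        (\<Sum>k<r1. (smult (L12 k) Q1 - smult (L23 k) Q3) * poly_subst \<sigma> (w k))"
      by (intro sum.cong) (simp_all only: lessThan_iff L(2))
    then show ?thesis
      by (simp only:) (simp add: lin_eval_def algebra_simps sum_subtractf sum.distrib sum_distrib_left)
  qed
  have \<psi>_lin: "?\<psi> L k12 \<in> lin_form" "?\<psi> L k13 \<in> lin_form" "?\<psi> L k23 \<in> lin_form" for L
    using lin0 k12(1) k13(1) k23(1) b2 by simp_all
  \<comment> \<open>The lifted Koszul syzygies map to the basis vectors \<open>e12\<close>,
    \<open>e13\<close>, \<open>e23\<close>; only the coordinate at \<open>e23\<close> is kept, which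
    suffices to detect the second Koszul syzygy.\<close>
  have \<psi>12: "?\<psi> L23 k12 = 0"
  proof -
    have "- ?\<psi> L12 k12 * Q2 - ?\<psi> L13 k12 * Q3 = - Q2"
      using \<phi>B[OF k12(2), of q1, unfolded \<kappa>1 \<phi>K sub] \<phi>c1 \<phi>c2 by simp
    moreover have "?\<psi> L12 k12 * Q1 - ?\<psi> L23 k12 * Q3 = Q1"
      using \<phi>B[OF k12(2), of q2, unfolded \<kappa>2 \<phi>K sub] \<phi>c1 \<phi>c2 by simp
    ultimately show ?thesis
      using Koszul_syzygy_unique[of "?\<psi> L12 k12" "?\<psi> L13 k12" "?\<psi> L23 k12" 1 0 0] \<psi>_lin
      by simp
  qed
  have \<psi>13: "?\<psi> L23 k13 = 0"
  proof -
    have "- ?\<psi> L12 k13 * Q2 - ?\<psi> L13 k13 * Q3 = - Q3"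
      using \<phi>B[OF k13(2), of q1, unfolded \<kappa>1 \<phi>K sub] \<phi>c1 \<phi>c3 by simp
    moreover have "?\<psi> L12 k13 * Q1 - ?\<psi> L23 k13 * Q3 = 0"
      using \<phi>B[OF k13(2), of q2, unfolded \<kappa>2 \<phi>K sub] \<phi>c1 \<phi>c3 by simp
    ultimately show ?thesis
      using Koszul_syzygy_unique[of "?\<psi> L12 k13" "?\<psi> L13 k13" "?\<psi> L23 k13" 0 1 0] \<psi>_lin
      by simp
  qed
  have \<psi>23: "?\<psi> L23 k23 = 1"
  proof -
    have "- ?\<psi> L12 k23 * Q2 - ?\<psi> L13 k23 * Q3 = 0"
      using \<phi>B[OF k23(2), of q1, unfolded \<kappa>1 \<phi>K sub] \<phi>c2 \<phi>c3 by simp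
    moreover have "?\<psi> L12 k23 * Q1 - ?\<psi> L23 k23 * Q3 = - Q3"
      using \<phi>B[OF k23(2), of q2, unfolded \<kappa>2 \<phi>K sub] \<phi>c2 \<phi>c3 by simp
    ultimately show ?thesis
      using Koszul_syzygy_unique[of "?\<psi> L12 k23" "?\<psi> L13 k23" "?\<psi> L23 k23" 0 0 1] \<psi>_lin
      by simp
  qed
  have "c \<ge> 2"
  proof (rule ccontr)
    assume "\<not> c \<ge> 2"
    then have c: "c \<le> 1" by simp
    \<comment> \<open>A column of \<open>D\<close> has Koszul coordinates that are at most linear
      and that the Koszul differential sends to 0, so injectivity applies.\<close>
    have D0: "?\<psi> L23 (\<lambda>j. D j k) = 0" if k: "k < r2" for k
    proof -
      let ?d = "\<lambda>j. D j k"
      have zero: "(\<Sum>j<r1. ?\<phi> q (\<lambda>l. B l j) * poly_subst \<sigma> (D j k)) = 0" for q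
        using lin_eval_cong[of r0, OF BD[OF _ k]] lin_eval_matrix[of \<sigma> r0 q B ?d r1] by simp
      have "?\<psi> L ?d \<in> lin_form" for L
        by (rule lin_eval_lin_form[OF D_hom[OF _ k] c lin])
      moreover have "- ?\<psi> L12 ?d * Q2 - ?\<psi> L13 ?d * Q3 = - 0 * Q2 - 0 * Q3"
        using zero[of q1, unfolded \<kappa>1] by simp
      moreover have "?\<psi> L12 ?d * Q1 - ?\<psi> L23 ?d * Q3 = 0 * Q1 - 0 * Q3"
        using zero[of q2, unfolded \<kappa>2] by simp
      ultimately show ?thesis
        using Koszul_syzygy_unique[of "?\<psi> L12 ?d" "?\<psi> L13 ?d" "?\<psi> L23 ?d" 0 0 0] lin_form_0 by blast
    qed
    txt \<open>Since \<open>?\<psi>\<close> kills the image of \<open>F\<^sub>2\<close>, it would kill the second Koszul syzygy.\<close>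
    define u where "u j = f1 * k23 j - f2 * k13 j + f3 * k12 j" for j
    have "\<exists>v. \<forall>l<r1. u l = (\<Sum>k<r2. D l k * v k)"
    proof (rule D_surj)
      fix j show "u j \<in> carrier (poly_ring V)"
        unfolding u_def using k12(1) k13(1) k23(1) b2
        by (intro carrier_add carrier_diff carrier_mult f_carr carrier_homogeneous_0) auto
    next
      fix l assume l: "l < r0"
      have "(\<Sum>k<r1. B l k * u k) = f1 * (\<Sum>k<r1. B l k * k23 k) - f2 * (\<Sum>k<r1. B l k * k13 k)
          + f3 * (\<Sum>k<r1. B l k * k12 k)"
        by (simp add: u_def algebra_simps sum_subtractf sum.distrib sum_distrib_left)
      also have "\<dots> = f1 * (f2 * c3 l - f3 * c2 l) - f2 * (f1 * c3 l - f3 * c1 l) + f3 * (f1 * c2 l - f2 * c1 l)"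
        using l by (simp add: k12(2) k13(2) k23(2))
      also have "\<dots> = 0" by (rule Koszul_identity)
      finally show "(\<Sum>k<r1. B l k * u k) = 0" .
    qed
    then obtain v where "\<And>l. l < r1 \<Longrightarrow> u l = (\<Sum>k<r2. D l k * v k)" by blast
    then have "?\<psi> L23 u = ?\<psi> L23 (\<lambda>l. \<Sum>k<r2. D l k * v k)"
      by (rule lin_eval_cong)
    also have "\<dots> = 0" using D0 by (simp add: lin_eval_matrix)
    finally have "?\<psi> L23 u = 0" .
    moreover have "?\<psi> L23 u = Q1"
      unfolding u_def lin_eval_add lin_eval_diff lin_eval_mult using \<psi>12 \<psi>13 \<psi>23 by (simp add: sub)
    ultimately show False by (simp add: Q_nonzero)
  qed
  then show ?thesis using b2 by simp
qed

text \<open>The relation in \<open>claw_identity\<close> gives a nonzero vector of linear forms in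
  the kernel of \<open>B\<close>, and columns of \<open>D\<close> of degree above 1 could not
  generate it.\<close>

lemma claw_degree:
  assumes "b = 2" and V: "v \<in> V" "i \<in> V" "j \<in> V" "k \<in> V" and "distinct [v, i, j, k]"
    and J: "edge_poly v i \<in> J" "edge_poly v j \<in> J" "edge_poly v k \<in> J"
  shows "c \<le> 1"
proof (rule ccontr)
  assume "\<not> c \<le> 1"
  let ?f = "edge_poly v :: 'v \<Rightarrow> ('v, 'k) pvpoly"
  let ?x = "poly_x :: 'v \<Rightarrow> ('v, 'k) pvpoly" and ?y = "poly_y :: 'v \<Rightarrow> ('v, 'k) pvpoly"
  define g where "g s t = ?x s * ?y t - ?x t * ?y s" for s t
  have f_carr: "?f s \<in> carrier (poly_ring V)" if "s \<in> V" for s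
    using that V by (simp add: carrier_edge_poly)
  have g_carr: "g s t \<in> carrier (poly_ring V)" if "s \<in> V" "t \<in> V" for s t
    unfolding g_def using that by (intro carrier_diff carrier_mult carrier_x carrier_y)
  have g_hom: "homogeneous 2 (g s t)" for s t
  proof -
    have "homogeneous (1 + 1) (g s t)"
      unfolding g_def by (intro homogeneous_diff homogeneous_mult homogeneous_pvar)
    then show ?thesis by simp
  qed
  obtain ci where ci: "\<And>k. homogeneous 0 (ci k)" "?f i = (\<Sum>k<r0. A k * ci k)"
    using generator_lift[OF J(1) homogeneous_edge_poly] by blast
  obtain cj where cj: "\<And>k. homogeneous 0 (cj k)" "?f j = (\<Sum>k<r0. A k * cj k)"
    using generator_lift[OF J(2) homogeneous_edge_poly] by blast
  obtain ck where ck: "\<And>k. homogeneous 0 (ck k)" "?f k = (\<Sum>k<r0. A k * ck k)"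
    using generator_lift[OF J(3) homogeneous_edge_poly] by blast
  obtain hij where hij: "\<And>k. homogeneous (2 - b) (hij k)"
    "\<And>l. l < r0 \<Longrightarrow> ?f i * cj l - ?f j * ci l = (\<Sum>k<r1. B l k * hij k)"
    using Koszul_lift[OF f_carr[OF V(2)] homogeneous_edge_poly ci(2,1) f_carr[OF V(3)] homogeneous_edge_poly cj(2,1)] by blast
  obtain hik where hik: "\<And>k. homogeneous (2 - b) (hik k)"
    "\<And>l. l < r0 \<Longrightarrow> ?f i * ck l - ?f k * ci l = (\<Sum>k<r1. B l k * hik k)"
    using Koszul_lift[OF f_carr[OF V(2)] homogeneous_edge_poly ci(2,1) f_carr[OF V(4)] homogeneous_edge_poly ck(2,1)] by blast
  obtain hjk where hjk: "\<And>k. homogeneous (2 - b) (hjk k)"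
    "\<And>l. l < r0 \<Longrightarrow> ?f j * ck l - ?f k * cj l = (\<Sum>k<r1. B l k * hjk k)"
    using Koszul_lift[OF f_carr[OF V(3)] homogeneous_edge_poly cj(2,1) f_carr[OF V(4)] homogeneous_edge_poly ck(2,1)] by blast
  txt \<open>The Pluecker relation between the three edges is a quadratic syzygy \<open>P\<close>; together with the
    Koszul syzygies it satisfies a linear relation \<open>u\<close>.\<close>
  define P where "P l = g j k * ci l - g i k * cj l + g i j * ck l" for l
  have "(\<Sum>l<r0. A l * P l) = g j k * (\<Sum>l<r0. A l * ci l) - g i k * (\<Sum>l<r0. A l * cj l)
      + g i j * (\<Sum>l<r0. A l * ck l)"
    by (simp add: P_def algebra_simps sum_subtractf sum.distrib sum_distrib_left)
  also have "\<dots> = g j k * ?f i - g i k * ?f j + g i j * ?f k"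
    by (simp only: ci(2) cj(2) ck(2))
  also have "\<dots> = 0" unfolding g_def edge_poly_def by (rule Pluecker_identity)
  finally have P0: "(\<Sum>l<r0. A l * P l) = 0" .
  obtain h where h: "\<And>k. homogeneous (2 - b) (h k)" "\<And>l. l < r0 \<Longrightarrow> P l = (\<Sum>k<r1. B l k * h k)"
  proof (rule syzygy_lift[OF _ _ P0])
    fix l
    show "P l \<in> carrier (poly_ring V)"
      unfolding P_def by (intro carrier_add carrier_diff carrier_mult g_carr V carrier_homogeneous_0 ci cj ck)
    have "homogeneous (2 + 0) (P l)"
      unfolding P_def by (intro homogeneous_add homogeneous_diff homogeneous_mult g_hom ci cj ck)
    then show "homogeneous 2 (P l)" by simp
  qed blast
  have h0: "homogeneous 0 (hij n)" "homogeneous 0 (hik n)" "homogeneous 0 (hjk n)" "homogeneous 0 (h n)" for n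
    using hij(1) hik(1) hjk(1) h(1) \<open>b = 2\<close> by simp_all
  define u where "u n = ?x i * hjk n - ?x j * hik n + ?x k * hij n + ?y v * h n" for n
  have "\<exists>z. \<forall>l<r1. u l = (\<Sum>n<r2. D l n * z n)"
  proof (rule D_surj)
    fix n show "u n \<in> carrier (poly_ring V)"
      unfolding u_def by (intro carrier_add carrier_diff carrier_mult carrier_x carrier_y V carrier_homogeneous_0 h0)
  next
    fix l assume l: "l < r0"
    have "(\<Sum>n<r1. B l n * u n) = ?x i * (\<Sum>n<r1. B l n * hjk n) - ?x j * (\<Sum>n<r1. B l n * hik n)
        + ?x k * (\<Sum>n<r1. B l n * hij n) + ?y v * (\<Sum>n<r1. B l n * h n)"
      by (simp add: u_def algebra_simps sum_subtractf sum.distrib sum_distrib_left)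
    also have "\<dots> = ?x i * (?f j * ck l - ?f k * cj l) - ?x j * (?f i * ck l - ?f k * ci l)
        + ?x k * (?f i * cj l - ?f j * ci l) + ?y v * P l"
      using l by (simp add: hij(2) hik(2) hjk(2) h(2))
    also have "\<dots> = 0"
      unfolding P_def g_def edge_poly_def by (rule claw_identity)
    finally show "(\<Sum>n<r1. B l n * u n) = 0" .
  qed
  then obtain z where z: "\<And>l. l < r1 \<Longrightarrow> u l = (\<Sum>n<r2. D l n * z n)" by blast
  have u_hom: "homogeneous 1 (u n)" for n
  proof -
    have "homogeneous (1 + 0) (u n)"
      unfolding u_def by (intro homogeneous_add homogeneous_diff homogeneous_mult homogeneous_pvar h0)
    then show ?thesis by simp
  qed
  obtain z' where z': "\<And>n. homogeneous (1 - c) (z' n)" "\<And>l. l < r1 \<Longrightarrow> u l = (\<Sum>n<r2. D l n * z' n)"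
    using homogeneous_lift[of r1 r2 c D 1 u z, OF D_hom u_hom z] by blast
  \<comment> \<open>The lift has degree \<open>1 - c < 0\<close>, so \<open>u\<close> would vanish.
    Setting variables to 0 and 1 now peels off its ingredients until an edge binomial becomes
    0.\<close>
  have "z' n = 0" for n
    using homogeneous_neg[OF z'(1)] \<open>\<not> c \<le> 1\<close> by simp
  then have u0: "u l = 0" if "l < r1" for l using z'(2)[OF that] by simp
  have neq: "j \<noteq> i" "k \<noteq> i" "j \<noteq> v" "k \<noteq> v" "k \<noteq> j" "j \<noteq> k" "v \<noteq> i"
    using assms(6) by auto
  have hjk0: "hjk l = 0" if "l < r1" for l
  proof -
    \<comment> \<open>The coefficients of \<open>u\<close> are constants, so this point isolates the
      one at \<open>?x i\<close>.\<close>
    have "poly_subst (\<lambda>w. if w = XVar i then 1 else 0) (u l) = 0" using u0[OF that] by simp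
    then have "[:Poly_Mapping.lookup (hjk l) 0:] = 0"
      using neq by (simp add: u_def poly_subst_add poly_subst_diff poly_subst_mult
        poly_subst_homogeneous_0[OF h0(3)])
    then show ?thesis using homogeneous_0_const[OF h0(3), of l] by simp
  qed
  have ck0: "ck l = 0" if l: "l < r0" for l
  proof -
    have "?f j * ck l - ?f k * cj l = 0" using hjk(2)[OF l] hjk0 by simp
    \<comment> \<open>At this point \<open>?f j\<close> is 1 and \<open>?f k\<close> is 0, which
      leaves the constant \<open>ck l\<close>.\<close>
    then have "poly_subst (\<lambda>w. if w = XVar v \<or> w = XVar j then 1 else 0) (?f j * ck l - ?f k * cj l) = 0"
      by simp
    then have "[:Poly_Mapping.lookup (ck l) 0:] = 0"
      using neq by (simp add: poly_subst_diff poly_subst_mult poly_subst_edge_poly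
        poly_subst_homogeneous_0[OF ck(1)])
    then show ?thesis using homogeneous_0_const[OF ck(1), of l] by simp
  qed
  have "?f k = 0" using ck(2) ck0 by simp
  then have "poly_subst (\<lambda>w. if w = XVar v \<or> w = XVar k then 1 else 0) (?f k) = (0 :: 'k poly)"
    by simp
  then show False by (simp add: poly_subst_edge_poly)
qed

end

section \<open>From a pure graded resolution to its first three matrices\<close>

lemma pure_shifts:
  assumes "pure_complex F"
  shows "\<exists>d. \<forall>k<rank_at F i. shifts F i ! k = d"
proof -
  have "shifts F i ! k = shifts F i ! 0" if k: "k < rank_at F i" for k
  proof -
    have "count_list (shifts F i) (shifts F i ! n) \<noteq> 0" if "n < rank_at F i" for n
      using that by (simp add: rank_at_def count_list_0_iff)
    from this[OF k] this[of 0] show ?thesis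
      using assms k unfolding pure_complex_def betti_def by simp
  qed
  then show ?thesis by blast
qed

lemma vec_in_free_module:
  "(\<And>k. k < r \<Longrightarrow> w k \<in> carrier (poly_ring V)) \<Longrightarrow> vec r w \<in> free_module V r"
  by (simp add: free_module_def)

lemma scalar_prod_vec:
  "v \<in> carrier_vec r \<Longrightarrow> a \<bullet> v = (\<Sum>k<r. a $ k * v $ k)"
  by (simp add: scalar_prod_def lessThan_atLeast0)

lemma mult_mat_vec_index:
  "M \<in> carrier_mat n r \<Longrightarrow> v \<in> carrier_vec r \<Longrightarrow> l < n \<Longrightarrow> (M *\<^sub>v v) $ l = (\<Sum>k<r. M $$ (l, k) * v $ k)"
  by (simp add: scalar_prod_def lessThan_atLeast0)

lemma two_syzygies_of_pure_resolution:
  fixes F :: "('v, 'k::comm_ring_1) graded_complex"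
  assumes wf: "pair_wf_digraph G"
    and res: "graded_free_resolution (pverts G) (parity_binomial_edge_ideal G) F"
    and pure: "pure_complex F"
    and edge: "(s, t) \<in> parcs G" "edge_poly s t \<noteq> (0 :: ('v, 'k) pvpoly)"
  obtains A B D r0 r1 r2 b c where
    "two_syzygies (pverts G) (parity_binomial_edge_ideal G :: ('v, 'k) pvpoly set) A B D r0 r1 r2 b c"
    "\<And>k. k < r0 \<Longrightarrow> A k \<in> parity_binomial_edge_ideal G"
proof -
  let ?V = "pverts G" and ?J = "parity_binomial_edge_ideal G :: ('v, 'k) pvpoly set"
  define r where "r = rank_at F"
  define A where "A k = augm F $ k" for k
  define B where "B i l k = bdry F i $$ (l, k)" for i l k
  \<comment> \<open>For a component of rank 0 the value \<open>d i\<close> is arbitrary; homogeneity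
    is only claimed of entries that exist.\<close>
  obtain d where d: "\<And>i k. k < r i \<Longrightarrow> shifts F i ! k = d i"
    using pure_shifts[OF pure] unfolding r_def by metis
  have maps: "graded_maps ?V F" using res by (simp add: graded_free_resolution_def)
  have A_hom: "homogeneous (d 0) (A k)" if "k < r 0" for k
    using maps d[OF that] that by (auto simp: graded_maps_def A_def r_def)
  have B_carr: "bdry F i \<in> carrier_mat (r i) (r (Suc i))" for i
    using maps by (auto simp: graded_maps_def r_def)
  have B_hom: "homogeneous (d (Suc i) - d i) (B i l k)" if "l < r i" "k < r (Suc i)" for i l k
  proof -
    have "homogeneous (shifts F (Suc i) ! k - shifts F i ! l) (B i l k)"
      using maps that by (simp add: graded_maps_def B_def r_def)
    then show ?thesis using d that by simp
  qed
  have fm: "v \<in> carrier_vec n" "\<And>k. k < n \<Longrightarrow> v $ k \<in> carrier (poly_ring ?V)"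
    if "v \<in> free_module ?V n" for v :: "('v, 'k) pvpoly vec" and n
    using that by (auto simp: free_module_def)
  have aug: "augm F \<bullet> v = (\<Sum>k<r 0. A k * v $ k)" if "v \<in> carrier_vec (r 0)" for v
    using scalar_prod_vec[OF that] by (simp add: A_def)
  have bdry: "(bdry F i *\<^sub>v v) $ l = (\<Sum>k<r (Suc i). B i l k * v $ k)"
    if "v \<in> carrier_vec (r (Suc i))" "l < r i" for i v l
    using mult_mat_vec_index[OF B_carr that] by (simp add: B_def)
  have ex0: "(\<lambda>v. augm F \<bullet> v) ` free_module ?V (r 0) = ?J"
    and ex1: "(\<lambda>v. bdry F 0 *\<^sub>v v) ` free_module ?V (r 1) = {w \<in> free_module ?V (r 0). augm F \<bullet> w = 0}"
    and ex2: "(\<lambda>v. bdry F 1 *\<^sub>v v) ` free_module ?V (r 2)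
      = {w \<in> free_module ?V (r 1). bdry F 0 *\<^sub>v w = 0\<^sub>v (r 0)}"
    using res unfolding graded_free_resolution_def r_def
    by (simp_all add: numeral_2_eq_2)
  have unit: "unit_vec n k \<in> free_module ?V n" for n k
    by (auto simp: free_module_def unit_vec_def)
  have sum_unit: "(\<Sum>j<n. f j * unit_vec n k $ j) = f k" if "k < n" for f :: "nat \<Rightarrow> ('v, 'k) pvpoly" and n k
  proof -
    have "(\<Sum>j<n. f j * unit_vec n k $ j) = (\<Sum>j<n. if j = k then f j else 0)"
      by (rule sum.cong) (auto simp: unit_vec_def)
    then show ?thesis using that by (simp add: sum.delta')
  qed
  have A_J: "A k \<in> ?J" if "k < r 0" for k
  proof -
    have "augm F \<bullet> unit_vec (r 0) k \<in> ?J" unfolding ex0[symmetric] by (rule imageI[OF unit])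
    then show ?thesis using aug[of "unit_vec (r 0) k"] sum_unit[OF that, of A] by simp
  qed
  have A_surj: "\<exists>v. p = (\<Sum>k<r 0. A k * v k)" if "p \<in> ?J" for p
  proof -
    from that obtain v where v: "p = augm F \<bullet> v" "v \<in> free_module ?V (r 0)"
      unfolding ex0[symmetric] by (rule imageE)
    show ?thesis unfolding v(1) aug[OF fm(1)[OF v(2)]] by (rule exI[of _ "\<lambda>k. v $ k"]) simp
  qed
  \<comment> \<open>The ideal has nothing below degree 2, and generators of higher degree could not
    reach the nonzero edge binomial.\<close>
  have d0: "d 0 = 2"
  proof -
    obtain v where v: "edge_poly s t = (\<Sum>k<r 0. A k * v k)"
      using A_surj[OF edge_poly_in_ideal[OF edge(1)]] by blast
    have "\<exists>k<r 0. A k \<noteq> 0"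
    proof (rule ccontr)
      assume "\<not> ?thesis"
      then show False using v edge(2) by simp
    qed
    then obtain k where k: "k < r 0" "A k \<noteq> 0" by blast
    \<comment> \<open>Only the vanishing below degree 2 is wanted here, so a trivial
      \<open>L\<close> and \<open>\<sigma>\<close> serve.\<close>
    have "hom_part (d 0) (A k) = 0" if "d 0 < 2"
      by (rule parity_ideal_hom_part(1)[OF wf, where L = UNIV and \<sigma> = "\<lambda>_. 0"])
        (use that A_J[OF k(1)] in simp_all)
    then have "\<not> d 0 < 2"
      using hom_part_of_homogeneous[OF A_hom[OF k(1)], of "d 0"] k(2) by auto
    moreover have "\<not> d 0 > 2"
    proof
      assume "d 0 > 2"
      have "edge_poly s t = hom_part 2 (edge_poly s t :: ('v, 'k) pvpoly)"
        by (simp add: hom_part_of_homogeneous[OF homogeneous_edge_poly])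
      also have "\<dots> = hom_part 2 (\<Sum>k<r 0. A k * v k)"
        by (simp only: v)
      also have "\<dots> = (\<Sum>k<r 0. A k * hom_part (2 - d 0) (v k))"
        by (simp add: hom_part_sum hom_part_mult[OF A_hom])
      also have "\<dots> = 0"
      proof -
        have "hom_part (2 - d 0) p = 0" for p :: "('v, 'k) pvpoly"
          by (rule homogeneous_neg[OF hom_part_homogeneous]) (use \<open>d 0 > 2\<close> in simp)
        then show ?thesis by simp
      qed
      finally show False using edge(2) by simp
    qed
    ultimately show ?thesis by simp
  qed
  have "two_syzygies ?V ?J A (B 0) (B 1) (r 0) (r 1) (r 2) (d 1 - d 0) (d 2 - d 1)"
  proof
    show "homogeneous 2 (A k)" if "k < r 0" for k using A_hom[OF that] d0 by simp
    show "homogeneous (d 1 - d 0) (B 0 l k)" if "l < r 0" "k < r 1" for l k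
      using B_hom[of l 0 k] that by simp
    show "homogeneous (d 2 - d 1) (B 1 l k)" if "l < r 1" "k < r 2" for l k
      using B_hom[of l 1 k] that by (simp add: numeral_2_eq_2)
    show "(\<Sum>l<r 0. A l * B 0 l k) = 0" if k: "k < r 1" for k
    proof -
      let ?w = "bdry F 0 *\<^sub>v unit_vec (r 1) k"
      have w: "?w \<in> free_module ?V (r 0)" "augm F \<bullet> ?w = 0"
        using imageI[OF unit[of "r 1" k], of "\<lambda>v. bdry F 0 *\<^sub>v v"] unfolding ex1 by simp_all
      have "?w $ l = B 0 l k" if "l < r 0" for l
        using bdry[of "unit_vec (r 1) k" 0 l] that sum_unit[OF k, of "B 0 l"] by simp
      then show ?thesis using aug[OF fm(1)[OF w(1)]] w(2) by simp
    qed
    show "(\<Sum>j<r 1. B 0 l j * B 1 j k) = 0" if l: "l < r 0" and k: "k < r 2" for l k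
    proof -
      let ?w = "bdry F 1 *\<^sub>v unit_vec (r 2) k"
      have w: "?w \<in> free_module ?V (r 1)" "bdry F 0 *\<^sub>v ?w = 0\<^sub>v (r 0)"
        using imageI[OF unit[of "r 2" k], of "\<lambda>v. bdry F 1 *\<^sub>v v"] unfolding ex2 by simp_all
      have *: "?w $ j = B 1 j k" if "j < r 1" for j
        using bdry[of "unit_vec (r 2) k" 1 j] that sum_unit[OF k, of "B 1 j"] by (simp add: numeral_2_eq_2)
      have "(bdry F 0 *\<^sub>v ?w) $ l = (\<Sum>j<r 1. B 0 l j * ?w $ j)"
        using bdry[of ?w 0 l] fm(1)[OF w(1)] l by simp
      then show ?thesis using w(2) l * by simp
    qed
    show "\<exists>v. p = (\<Sum>k<r 0. A k * v k)" if "p \<in> ?J" for p using A_surj[OF that] .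
    show "\<exists>v. \<forall>l<r 0. w l = (\<Sum>k<r 1. B 0 l k * v k)"
      if w: "\<And>l. l < r 0 \<Longrightarrow> w l \<in> carrier (poly_ring ?V)" "(\<Sum>l<r 0. A l * w l) = 0" for w
    proof -
      have "vec (r 0) w \<in> free_module ?V (r 0)" using w(1) by (rule vec_in_free_module)
      moreover have "augm F \<bullet> vec (r 0) w = 0" using aug[of "vec (r 0) w"] w(2) by simp
      ultimately have "vec (r 0) w \<in> (\<lambda>v. bdry F 0 *\<^sub>v v) ` free_module ?V (r 1)"
        unfolding ex1 by simp
      then obtain v where v: "vec (r 0) w = bdry F 0 *\<^sub>v v" "v \<in> free_module ?V (r 1)"
        by (rule imageE)
      have "w l = (\<Sum>k<r 1. B 0 l k * v $ k)" if "l < r 0" for l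
        using bdry[of v 0 l] fm(1)[OF v(2)] that by (simp flip: v(1))
      then show ?thesis by blast
    qed
    show "\<exists>v. \<forall>l<r 1. w l = (\<Sum>k<r 2. B 1 l k * v k)"
      if w: "\<And>l. l < r 1 \<Longrightarrow> w l \<in> carrier (poly_ring ?V)"
        "\<And>l. l < r 0 \<Longrightarrow> (\<Sum>k<r 1. B 0 l k * w k) = 0" for w
    proof -
      have "vec (r 1) w \<in> free_module ?V (r 1)" using w(1) by (rule vec_in_free_module)
      moreover have "bdry F 0 *\<^sub>v vec (r 1) w = 0\<^sub>v (r 0)"
      proof (rule eq_vecI)
        fix l assume "l < dim_vec (0\<^sub>v (r 0) :: ('v, 'k) pvpoly vec)"
        then show "(bdry F 0 *\<^sub>v vec (r 1) w) $ l = 0\<^sub>v (r 0) $ l"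
          using bdry[of "vec (r 1) w" 0 l] w(2)[of l] by simp
      qed (use B_carr[of 0] in simp)
      ultimately have "vec (r 1) w \<in> (\<lambda>v. bdry F 1 *\<^sub>v v) ` free_module ?V (r 2)"
        unfolding ex2 by simp
      then obtain v where v: "vec (r 1) w = bdry F 1 *\<^sub>v v" "v \<in> free_module ?V (r 2)"
        by (rule imageE)
      have "w l = (\<Sum>k<r 2. B 1 l k * v $ k)" if "l < r 1" for l
      proof -
        have "w l = (bdry F 1 *\<^sub>v v) $ l" unfolding v(1)[symmetric] using that by simp
        then show ?thesis
          using bdry[of v 1 l] fm(1)[OF v(2)] that by (simp add: numeral_2_eq_2)
      qed
      then show ?thesis by blast
    qed
  qed
  then show thesis using that A_J by blast
qed

lemma edge_poly_nonzero: "i \<noteq> j \<Longrightarrow> (edge_poly i j :: ('v, 'k::comm_ring_1) pvpoly) \<noteq> 0"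
proof
  assume "edge_poly i j = (0 :: ('v, 'k) pvpoly)"
  then have "poly_subst (\<lambda>w. if w = XVar i \<or> w = XVar j then 1 else 0) (edge_poly i j) = (0 :: 'k poly)"
    by simp
  then show False by (simp add: poly_subst_edge_poly)
qed

text \<open>The bounds \<open>c \<ge> 2\<close> from the substitution and \<open>c \<le> 1\<close>
  from the claw concern the same \<open>c\<close>. Nothing relates \<open>\<sigma>\<close> to the
  vertices of the claw.\<close>

lemma no_claw_of_pure:
  fixes F :: "('v, 'k::comm_ring_1) graded_complex" and \<sigma> :: "'v pvar \<Rightarrow> 'k poly"
  assumes wf: "pair_wf_digraph G"
    and res: "graded_free_resolution (pverts G) (parity_binomial_edge_ideal G) F"
    and pure: "pure_complex F"
    and claw: "(v, i) \<in> parcs G" "(v, j) \<in> parcs G" "(v, k) \<in> parcs G" "distinct [v, i, j, k]"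
    and lin: "\<And>z. \<sigma> z \<in> lin_form"
    and span: "\<And>i j. (i, j) \<in> parcs G \<Longrightarrow> \<sigma> (XVar i) * \<sigma> (XVar j) - \<sigma> (YVar i) * \<sigma> (YVar j) \<in> Q_span"
    and f: "f1 \<in> parity_binomial_edge_ideal G" "f2 \<in> parity_binomial_edge_ideal G" "f3 \<in> parity_binomial_edge_ideal G"
    and f_hom: "homogeneous 2 f1" "homogeneous 2 f2" "homogeneous 2 f3"
    and f_carr: "f1 \<in> carrier (poly_ring (pverts G))" "f2 \<in> carrier (poly_ring (pverts G))"
      "f3 \<in> carrier (poly_ring (pverts G))"
    and sub: "poly_subst \<sigma> f1 = Q1" "poly_subst \<sigma> f2 = Q2" "poly_subst \<sigma> f3 = Q3"
  shows False
proof -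
  interpret pair_wf_digraph G by fact
  have "edge_poly v i \<noteq> (0 :: ('v, 'k) pvpoly)" using claw(4) by (simp add: edge_poly_nonzero)
  then obtain A B D r0 r1 r2 b c where
    two: "two_syzygies (pverts G) (parity_binomial_edge_ideal G :: ('v, 'k) pvpoly set) A B D r0 r1 r2 b c"
    and A: "\<And>k. k < r0 \<Longrightarrow> A k \<in> parity_binomial_edge_ideal G"
    using two_syzygies_of_pure_resolution[OF wf res pure claw(1)] by metis
  interpret two_syzygies "pverts G" "parity_binomial_edge_ideal G" A B D r0 r1 r2 b c by (fact two)
  have "poly_subst \<sigma> (A k) \<in> Q_span" if k: "k < r0" for k
  proof -
    have "poly_subst \<sigma> (hom_part 2 (A k)) \<in> Q_span"
      using Q_span_0 Q_span_add Q_span_smult span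
      by (intro parity_ideal_hom_part(2)[OF wf _ _ _ _ A[OF k]]) (auto simp: poly_subst_edge_poly)
    then show ?thesis using hom_part_of_homogeneous[OF A_hom[OF k]] by simp
  qed
  then have "b = 2 \<and> c \<ge> 2"
    using regular_triple_degrees[of \<sigma> f1 f2 f3] lin f f_hom f_carr sub by blast
  moreover have "c \<le> 1" if "b = 2"
    using that claw edge_poly_in_ideal in_arcsD1[OF claw(1)] in_arcsD2[OF claw(1)]
      in_arcsD2[OF claw(2)] in_arcsD2[OF claw(3)]
    by (intro claw_degree[of v i j k]) auto
  ultimately show False by simp
qed

section \<open>The substitutions for a triangle and for an induced path\<close>

lemma form_in_lin_form [simp]:
  "[:0, 1:] \<in> lin_form" "[:0, 0, 0, 0, 0, 1:] \<in> lin_form" "[:0, 1, 0, 0, 0, 1:] \<in> lin_form"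
  unfolding lin_form_def by force+

lemma Q_in_Q_span [simp]:
  "(Q1 :: 'a::comm_ring_1 poly) \<in> Q_span" "(Q2 :: 'a poly) \<in> Q_span" "(Q3 :: 'a poly) \<in> Q_span"
  "(Q1 + Q2 :: 'a poly) \<in> Q_span" "(Q2 + Q3 :: 'a poly) \<in> Q_span" "(0 :: 'a poly) \<in> Q_span"
proof -
  have Q: "smult a Q1 + smult b Q2 + smult c Q3 \<in> Q_span" for a b c :: 'a
    unfolding Q_span_def by blast
  show "(Q1 :: 'a poly) \<in> Q_span" using Q[of 1 0 0] by simp
  show "(Q2 :: 'a poly) \<in> Q_span" using Q[of 0 1 0] by simp
  show "(Q3 :: 'a poly) \<in> Q_span" using Q[of 0 0 1] by simp
  show "(Q1 + Q2 :: 'a poly) \<in> Q_span" using Q[of 1 1 0] by simp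
  show "(Q2 + Q3 :: 'a poly) \<in> Q_span" using Q[of 0 1 1] by simp
  show "(0 :: 'a poly) \<in> Q_span" by (rule Q_span_0)
qed

theorem theorem1:
  fixes G :: "'v pair_pre_digraph"
    and F :: "('v, 'k::field) graded_complex"
  assumes "pair_graph G"
    and "Digraph_Component.connected (with_proj G)"
    and "minimal_graded_free_resolution (pverts G) (parity_binomial_edge_ideal G) F"
    and "pure_complex F"
  shows "bipartite G \<or> odd_cycle G"
proof (rule ccontr)
  assume neg: "\<not> ?thesis"
  interpret pair_graph G by fact
  have sym: "(v, u) \<in> parcs G" if "(u, v) \<in> parcs G" for u v
    using that sym_arcs by (auto simp: symmetric_def dest: symD)
  have irr: "(u, u) \<notin> parcs G" for u
    using no_loops by fastforce
  have wf: "pair_wf_digraph G" by unfold_locales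
  have res: "graded_free_resolution (pverts G) (parity_binomial_edge_ideal G) F"
    using assms(3) by (simp add: minimal_graded_free_resolution_def)
  obtain v i j k where claw: "(v, i) \<in> parcs G" "(v, j) \<in> parcs G" "(v, k) \<in> parcs G" "distinct [i, j, k]"
    using bipartite_or_odd_cycle_if_degree_le_2[OF assms(1,2)] neg by blast
  then have claw': "distinct [v, i, j, k]" using irr by auto
  let ?f = "edge_poly :: 'v \<Rightarrow> 'v \<Rightarrow> ('v, 'k) pvpoly"
  have J: "?f s t \<in> parity_binomial_edge_ideal G" if "(s, t) \<in> parcs G" for s t
    using that by (rule edge_poly_in_ideal)
  have carr: "?f s t \<in> carrier (poly_ring (pverts G))" if "(s, t) \<in> parcs G" for s t
    using in_arcsD1[OF that] in_arcsD2[OF that] by (rule carrier_edge_poly)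
  note no_claw = no_claw_of_pure[OF wf res assms(4) claw(1-3) claw']
  consider (triangle) a b c where "(a, b) \<in> parcs G" "(b, c) \<in> parcs G" "(a, c) \<in> parcs G"
    | (P4) a b c d where "(a, b) \<in> parcs G" "(b, c) \<in> parcs G" "(c, d) \<in> parcs G" "distinct [a, b, c, d]"
      "(a, c) \<notin> parcs G" "(b, d) \<notin> parcs G" "(a, d) \<notin> parcs G"
    using bipartite_if_no_triangle_no_induced_P4[OF assms(1,2)] neg by metis
  then show False
  proof cases
    case triangle
    \<comment> \<open>The x-variables of a, b, c become \<open>p\<close>, \<open>r\<close>,
      \<open>p + r\<close> and their y-variables \<open>q\<close>. The edges ab, ac, bc then give
      \<open>Q2\<close>, \<open>Q1 + Q2\<close>, \<open>Q2 + Q3\<close>, so subtracting the first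
      from the others yields \<open>Q1\<close> and \<open>Q3\<close>.\<close>
    define \<sigma> :: "'v pvar \<Rightarrow> 'k poly" where "\<sigma> z = (if z = XVar a then [:0, 1:] else
      if z = XVar b then [:0, 0, 0, 0, 0, 1:] else if z = XVar c then [:0, 1, 0, 0, 0, 1:] else
      if z \<in> {YVar a, YVar b, YVar c} then 1 else 0)" for z
    have neq: "a \<noteq> b" "b \<noteq> a" "a \<noteq> c" "c \<noteq> a" "b \<noteq> c" "c \<noteq> b" using triangle irr by auto
    let ?e = "\<lambda>s t. \<sigma> (XVar s) * \<sigma> (XVar t) - \<sigma> (YVar s) * \<sigma> (YVar t)"
    have e: "?e a b = Q2" "?e b a = Q2" "?e a c = Q1 + Q2" "?e c a = Q1 + Q2" "?e b c = Q2 + Q3" "?e c b = Q2 + Q3"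
      using neq by (simp_all add: \<sigma>_def Q1_def Q2_def Q3_def one_pCons)
    show False
    proof (rule no_claw[of \<sigma> "?f a c - ?f a b" "?f a b" "?f b c - ?f a b"])
      show "\<sigma> z \<in> lin_form" for z by (simp add: \<sigma>_def)
      show "?e s t \<in> Q_span" if st: "(s, t) \<in> parcs G" for s t
      proof (cases "s \<in> {a, b, c} \<and> t \<in> {a, b, c}")
        case True
        then have "(s, t) \<in> {(a, b), (b, a), (a, c), (c, a), (b, c), (c, b)}"
          using st irr by auto
        then show ?thesis by (elim insertE) (simp_all only: prod.inject e Q_in_Q_span empty_iff)
      next
        case False
        moreover have "\<sigma> (XVar x) = 0 \<and> \<sigma> (YVar x) = 0" if "x \<notin> {a, b, c}" for x
          using that by (simp add: \<sigma>_def)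
        ultimately have "?e s t = 0" by (metis diff_self mult_zero_left mult_zero_right)
        then show ?thesis by simp
      qed
    qed (simp_all add: poly_subst_diff poly_subst_edge_poly e diff_in_ideal[OF wf] J carr carrier_diff
        homogeneous_diff triangle)
  next
    case P4
    \<comment> \<open>Along the path the x-variables become \<open>p\<close>, \<open>p\<close>,
      \<open>r\<close>, \<open>r\<close> and the y-variables \<open>0\<close>, \<open>q\<close>,
      \<open>q\<close>, \<open>0\<close>: the zeros at the ends remove \<open>q\<close> from the
      outer edges, which leaves the squares \<open>p^2\<close> and \<open>r^2\<close>. There are no
      chords to check because the path is induced.\<close>
    define \<sigma> :: "'v pvar \<Rightarrow> 'k poly" where "\<sigma> z = (if z \<in> {XVar a, XVar b} then [:0, 1:] else
      if z \<in> {XVar c, XVar d} then [:0, 0, 0, 0, 0, 1:] else if z \<in> {YVar b, YVar c} then 1 else 0)" for z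
    have neq: "a \<noteq> b" "b \<noteq> a" "a \<noteq> c" "c \<noteq> a" "b \<noteq> c" "c \<noteq> b" "a \<noteq> d" "d \<noteq> a" "b \<noteq> d" "d \<noteq> b" "c \<noteq> d" "d \<noteq> c"
      using P4(4) by auto
    let ?e = "\<lambda>s t. \<sigma> (XVar s) * \<sigma> (XVar t) - \<sigma> (YVar s) * \<sigma> (YVar t)"
    have e: "?e a b = Q1" "?e b a = Q1" "?e b c = Q2" "?e c b = Q2" "?e c d = Q3" "?e d c = Q3"
      using neq by (simp_all add: \<sigma>_def Q1_def Q2_def Q3_def one_pCons)
    show False
    proof (rule no_claw[of \<sigma> "?f a b" "?f b c" "?f c d"])
      show "\<sigma> z \<in> lin_form" for z by (simp add: \<sigma>_def)
      show "?e s t \<in> Q_span" if st: "(s, t) \<in> parcs G" for s t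
      proof (cases "s \<in> {a, b, c, d} \<and> t \<in> {a, b, c, d}")
        case True
        then have "(s, t) \<in> {(a, b), (b, a), (b, c), (c, b), (c, d), (d, c)}"
          using st sym[OF st] irr P4(5-7) by auto
        then show ?thesis by (elim insertE) (simp_all only: prod.inject e Q_in_Q_span empty_iff)
      next
        case False
        moreover have "\<sigma> (XVar x) = 0 \<and> \<sigma> (YVar x) = 0" if "x \<notin> {a, b, c, d}" for x
          using that by (simp add: \<sigma>_def)
        ultimately have "?e s t = 0" by (metis diff_self mult_zero_left mult_zero_right)
        then show ?thesis by simp
      qed
    qed (simp_all add: poly_subst_edge_poly e J carr P4(1-3))
  qed
qed

end
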